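(* Let $N\subset B(H)$ be a von Neumann algebra on a Hilbert space $H$, let $(S,+,0)$ be a commutative semigroup with unit $0$, and let $\{\phi_s\}_{s\in S}$ be a semigroup of completely positive, contractive, weak*-continuous linear maps $N\to N$ (i.e. $\phi_0=\mathrm{id}_N$ and $\phi_{s+t}=\phi_s\circ\phi_t$ for all $s,t\in S$). Let $N^\phi=\{x\in N:\phi_t(x)=x\ \forall t\in S\}$ and let $C^*(N^\phi)$ be the $C^*$-subalgebra of $N$ generated by $N^\phi$. Then for each $y\in C^*(N^\phi)$ the strong-operator limit $\Phi(y)=\text{so-}\lim_{s\in S}\phi_s(y)$ exists, and the map $y\mapsto\Phi(y)$ is completely positive, contractive and idempotent, with range equal to $N^\phi$.
   Context: For a commutative semigroup $(S,+,0)$ with unit, $S$ is given the preorder $s\le t$ iff there exists $r\in S$ with $s+r=t$; this makes $S$ a directed set, and $\lim_{s\in S}$ denotes the limit of a net along this directed set. "so-lim" means the limit in the strong operator topology of $B(H)$. *)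

theory Defs
  imports Complex_Main
begin

class chilbert = ab_group_add +
  fixes scaleC :: "complex \<Rightarrow> 'a \<Rightarrow> 'a"
    and cinner :: "'a \<Rightarrow> 'a \<Rightarrow> complex"
  assumes scaleC_add_right: "scaleC a (x + y) = scaleC a x + scaleC a y"
    and scaleC_add_left: "scaleC (a + b) x = scaleC a x + scaleC b x"
    and scaleC_scaleC: "scaleC a (scaleC b x) = scaleC (a * b) x"
    and scaleC_one: "scaleC 1 x = x"
    and cinner_add_left: "cinner (x + y) z = cinner x z + cinner y z"
    and cinner_scaleC_left: "cinner (scaleC a x) y = a * cinner x y"
    and cinner_commute: "cinner y x = cnj (cinner x y)"
    and cinner_nonneg: "0 \<le> Re (cinner x x)"
    and cinner_zero: "cinner x x = 0 \<Longrightarrow> x = 0"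
    and hilbert_complete:
      "(\<forall>e>0. \<exists>M::nat. \<forall>m\<ge>M. \<forall>n\<ge>M. sqrt (Re (cinner (f m - f n) (f m - f n))) < e)
        \<Longrightarrow> (\<exists>l. \<forall>e>0. \<exists>M::nat. \<forall>n\<ge>M. sqrt (Re (cinner (f n - l) (f n - l))) < e)"

definition hnorm :: "'h::chilbert \<Rightarrow> real" where
  "hnorm x = sqrt (Re (cinner x x))"

definition bounded_op :: "('h::chilbert \<Rightarrow> 'h) \<Rightarrow> bool" where
  "bounded_op T \<longleftrightarrow> (\<forall>x y. T (x + y) = T x + T y) \<and> (\<forall>c x. T (scaleC c x) = scaleC c (T x))
     \<and> (\<exists>K. \<forall>x. hnorm (T x) \<le> K * hnorm x)"

definition opnorm :: "('h::chilbert \<Rightarrow> 'h) \<Rightarrow> real" where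
  "opnorm T = Sup {hnorm (T x) | x. hnorm x \<le> 1}"

definition adjoint :: "('h::chilbert \<Rightarrow> 'h) \<Rightarrow> ('h \<Rightarrow> 'h)" where
  "adjoint T = (THE S. \<forall>x y. cinner (T x) y = cinner x (S y))"

definition op_add :: "('h::chilbert \<Rightarrow> 'h) \<Rightarrow> ('h \<Rightarrow> 'h) \<Rightarrow> ('h \<Rightarrow> 'h)" where
  "op_add S T = (\<lambda>x. S x + T x)"

definition op_diff :: "('h::chilbert \<Rightarrow> 'h) \<Rightarrow> ('h \<Rightarrow> 'h) \<Rightarrow> ('h \<Rightarrow> 'h)" where
  "op_diff S T = (\<lambda>x. S x - T x)"

definition op_scale :: "complex \<Rightarrow> ('h::chilbert \<Rightarrow> 'h) \<Rightarrow> ('h \<Rightarrow> 'h)" where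
  "op_scale c T = (\<lambda>x. scaleC c (T x))"

definition commutant :: "('h::chilbert \<Rightarrow> 'h) set \<Rightarrow> ('h \<Rightarrow> 'h) set" where
  "commutant A = {T. bounded_op T \<and> (\<forall>a\<in>A. T \<circ> a = a \<circ> T)}"

text \<open>A von Neumann algebra on H: a self-adjoint set of bounded operators equal to its
  double commutant (equivalently, a unital weak-operator closed *-subalgebra of B(H)).\<close>

definition von_neumann_algebra :: "('h::chilbert \<Rightarrow> 'h) set \<Rightarrow> bool" where
  "von_neumann_algebra N \<longleftrightarrow> N \<subseteq> Collect bounded_op \<and> (\<forall>x\<in>N. adjoint x \<in> N)
     \<and> N = commutant (commutant N)"

definition cstar_subalgebra :: "('h::chilbert \<Rightarrow> 'h) set \<Rightarrow> bool" where
  "cstar_subalgebra A \<longleftrightarrow> A \<subseteq> Collect bounded_op \<and> (\<lambda>x. 0) \<in> A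
     \<and> (\<forall>a\<in>A. \<forall>b\<in>A. op_add a b \<in> A \<and> a \<circ> b \<in> A)
     \<and> (\<forall>c. \<forall>a\<in>A. op_scale c a \<in> A) \<and> (\<forall>a\<in>A. adjoint a \<in> A)
     \<and> (\<forall>T. bounded_op T \<longrightarrow> (\<forall>e>0. \<exists>a\<in>A. opnorm (op_diff T a) < e) \<longrightarrow> T \<in> A)"

definition cstar_generated :: "('h::chilbert \<Rightarrow> 'h) set \<Rightarrow> ('h \<Rightarrow> 'h) set" where
  "cstar_generated X = \<Inter> {A. cstar_subalgebra A \<and> X \<subseteq> A}"

definition linear_on :: "('h::chilbert \<Rightarrow> 'h) set \<Rightarrow> (('h \<Rightarrow> 'h) \<Rightarrow> ('h \<Rightarrow> 'h)) \<Rightarrow> bool" where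
  "linear_on A f \<longleftrightarrow> (\<forall>a\<in>A. \<forall>b\<in>A. f (op_add a b) = op_add (f a) (f b))
     \<and> (\<forall>c. \<forall>a\<in>A. f (op_scale c a) = op_scale c (f a))"

definition pos_matrix :: "nat \<Rightarrow> (nat \<Rightarrow> nat \<Rightarrow> ('h::chilbert \<Rightarrow> 'h)) \<Rightarrow> bool" where
  "pos_matrix n X \<longleftrightarrow> (\<forall>\<xi> :: nat \<Rightarrow> 'h.
      let q = (\<Sum>i<n. \<Sum>j<n. cinner (X i j (\<xi> j)) (\<xi> i)) in Im q = 0 \<and> 0 \<le> Re q)"

definition completely_positive :: "('h::chilbert \<Rightarrow> 'h) set \<Rightarrow> (('h \<Rightarrow> 'h) \<Rightarrow> ('h \<Rightarrow> 'h)) \<Rightarrow> bool" where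
  "completely_positive A f \<longleftrightarrow> linear_on A f \<and>
     (\<forall>n X. (\<forall>i<n. \<forall>j<n. X i j \<in> A) \<longrightarrow> pos_matrix n X \<longrightarrow> pos_matrix n (\<lambda>i j. f (X i j)))"

definition contractive :: "('h::chilbert \<Rightarrow> 'h) set \<Rightarrow> (('h \<Rightarrow> 'h) \<Rightarrow> ('h \<Rightarrow> 'h)) \<Rightarrow> bool" where
  "contractive A f \<longleftrightarrow> (\<forall>a\<in>A. opnorm (f a) \<le> opnorm a)"

text \<open>Normal (sigma-weakly continuous) functionals on N: restrictions to N of
  \<open>x \<mapsto> \<Sum>n \<langle>x \<xi>_n, \<eta>_n\<rangle>\<close> with \<open>\<Sum>\<parallel>\<xi>_n\<parallel>\<^sup>2, \<Sum>\<parallel>\<eta>_n\<parallel>\<^sup>2 < \<infinity>\<close>.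
  These form the predual, and the weak* (= sigma-weak) topology on N is the weak topology they induce.\<close>

definition normal_functional :: "('h::chilbert \<Rightarrow> 'h) set \<Rightarrow> (('h \<Rightarrow> 'h) \<Rightarrow> complex) \<Rightarrow> bool" where
  "normal_functional N \<omega> \<longleftrightarrow> (\<exists>\<xi> \<eta> :: nat \<Rightarrow> 'h.
      summable (\<lambda>n. (hnorm (\<xi> n))\<^sup>2) \<and> summable (\<lambda>n. (hnorm (\<eta> n))\<^sup>2) \<and>
      (\<forall>x\<in>N. \<omega> x = (\<Sum>n. cinner (x (\<xi> n)) (\<eta> n))))"

text \<open>A linear map N \<rightarrow> N is weak*-continuous iff it pulls back weak*-continuous functionals
  to weak*-continuous functionals.\<close>

definition weak_star_continuous :: "('h::chilbert \<Rightarrow> 'h) set \<Rightarrow> (('h \<Rightarrow> 'h) \<Rightarrow> ('h \<Rightarrow> 'h)) \<Rightarrow> bool" where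
  "weak_star_continuous N f \<longleftrightarrow> (\<forall>\<omega>. normal_functional N \<omega> \<longrightarrow> normal_functional N (\<omega> \<circ> f))"

definition sot_net_limit :: "('s::comm_monoid_add \<Rightarrow> ('h::chilbert \<Rightarrow> 'h)) \<Rightarrow> ('h \<Rightarrow> 'h) \<Rightarrow> bool" where
  "sot_net_limit f L \<longleftrightarrow> (\<forall>\<xi>. \<forall>e>0. \<exists>s0. \<forall>s. (\<exists>r. s0 + r = s) \<longrightarrow> hnorm (f s \<xi> - L \<xi>) < e)"

definition fixed_points :: "('h::chilbert \<Rightarrow> 'h) set \<Rightarrow> ('s \<Rightarrow> ('h \<Rightarrow> 'h) \<Rightarrow> ('h \<Rightarrow> 'h)) \<Rightarrow> ('h \<Rightarrow> 'h) set" where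
  "fixed_points N \<phi> = {x \<in> N. \<forall>t. \<phi> t x = x}"

end

theory Submission
  imports "HOL-Analysis.Uniform_Limit" Defs
begin

text \<open>Let \<open>J\<close> be the set of \<open>d \<in> N\<close> with \<open>\<phi> s (d\<^sup>* d) \<rightarrow> 0\<close> weakly. By the Schwarz inequality
  \<open>\<phi> s (x)\<^sup>* \<phi> s (x) \<le> \<phi> s (x\<^sup>* x)\<close>, \<open>J\<close> is a norm-closed left ideal on which \<open>\<phi> s\<close> tends strongly
  to \<open>0\<close>. For a fixed point \<open>a\<close> the net \<open>\<phi> s (a\<^sup>* a)\<close> increases to a fixed point \<open>c\<close>, and
  \<open>c - a\<^sup>* a \<in> J\<close>; by polarization, a product of two fixed points is a fixed point modulo \<open>J\<close>.
  As \<open>J\<close> is a left ideal, the norm-closed space of fixed points modulo \<open>J\<close> is then stable under left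
  multiplication by fixed points, so it contains the C*-algebra they generate. The limit map picks the
  fixed point in the class of \<open>y\<close> modulo \<open>J\<close>.\<close>

text \<open>The maps \<open>\<phi> s\<close> are not multiplicative, so a product of fixed points
  need not be fixed, and nothing forces its orbit to converge a priori. Smallness is measured by
  \<open>d\<^sup>* d\<close> because \<open>(z d)\<^sup>* (z d) \<le> K\<^sup>2 d\<^sup>* d\<close>,
  with \<open>K\<close> the norm of \<open>z\<close>, survives positive maps. There is no such
  inequality for \<open>d z\<close> or for the adjoint of \<open>d\<close>: the ideal is one-sided
  and not visibly self-adjoint, so adjoints have to be carried along by hand when the C*-algebra is
  reached. Contractivity acts twice. It gives \<open>\<phi> s 1 \<le> 1\<close>, which stands in for
  unitality in the Schwarz inequality, and it makes the passage from \<open>y\<close> to its fixed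
  representative norm-decreasing, which yields norm closedness. Weak* continuity is what makes the
  limit of the increasing net \<open>\<phi> s (a\<^sup>* a)\<close> a fixed point.\<close>

hide_const (open) Linear_Algebra.adjoint

section \<open>Hilbert space geometry\<close>

lemma cinner_zero_left [simp]: "cinner 0 (x::'h::chilbert) = 0"
  using cinner_add_left[of 0 0 x] by simp

lemma cinner_zero_right [simp]: "cinner (x::'h::chilbert) 0 = 0"
  by (subst cinner_commute) simp

lemma cinner_minus_left: "cinner (- x) y = - cinner (x::'h::chilbert) y"
  using cinner_add_left[of x "- x" y] by (simp add: add_eq_0_iff)

lemma cinner_diff_left: "cinner (x - y) z = cinner x z - cinner (y::'h::chilbert) z"
  using cinner_add_left[of x "- y" z] by (simp add: cinner_minus_left)

lemma cinner_add_right: "cinner z (x + y) = cinner z x + cinner z (y::'h::chilbert)"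
  by (subst (1 2 3) cinner_commute) (simp add: cinner_add_left)

lemma cinner_minus_right: "cinner y (- x) = - cinner y (x::'h::chilbert)"
  by (subst (1 2) cinner_commute) (simp add: cinner_minus_left)

lemma cinner_diff_right: "cinner z (x - y) = cinner z x - cinner z (y::'h::chilbert)"
  by (subst (1 2 3) cinner_commute) (simp add: cinner_diff_left)

lemma cinner_scaleC_right: "cinner x (scaleC a y) = cnj a * cinner x (y::'h::chilbert)"
  by (subst (1 2) cinner_commute) (simp add: cinner_scaleC_left)

lemmas cinner_simps = cinner_add_left cinner_add_right cinner_diff_left cinner_diff_right
  cinner_minus_left cinner_minus_right cinner_scaleC_left cinner_scaleC_right

lemma scaleC_zero_right [simp]: "scaleC a (0::'h::chilbert) = 0"
  using scaleC_add_right[of a 0 "0::'h"] by simp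

lemma scaleC_zero_left [simp]: "scaleC 0 (x::'h::chilbert) = 0"
  using scaleC_add_left[of 0 0 x] by simp

lemma scaleC_minus_right: "scaleC a (- x) = - scaleC a (x::'h::chilbert)"
  using scaleC_add_right[of a x "- x"] by (simp add: eq_neg_iff_add_eq_0 add.commute)

lemma scaleC_diff_right: "scaleC a (x - y) = scaleC a x - scaleC a (y::'h::chilbert)"
  using scaleC_add_right[of a x "- y"] by (simp add: scaleC_minus_right)

lemma scaleC_minus1: "scaleC (- 1) x = - (x::'h::chilbert)"
  using scaleC_add_left[of 1 "- 1" x] by (simp add: scaleC_one eq_neg_iff_add_eq_0 add.commute)

lemma cinner_same: "cinner x x = complex_of_real ((hnorm (x::'h::chilbert))\<^sup>2)"
proof -
  have "cinner x x = cnj (cinner x x)"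
    by (rule cinner_commute)
  then have "Im (cinner x x) = 0"
    by (simp add: complex_eq_iff)
  then show ?thesis
    using cinner_nonneg[of x] by (simp add: complex_eq_iff hnorm_def)
qed

lemma Re_cinner_commute: "Re (cinner x y) = Re (cinner y (x::'h::chilbert))"
  by (subst cinner_commute) simp

lemma hnorm_sq: "(hnorm (x::'h::chilbert))\<^sup>2 = Re (cinner x x)"
  using cinner_nonneg[of x] by (simp add: hnorm_def)

lemma hnorm_ge_zero [simp]: "0 \<le> hnorm (x::'h::chilbert)"
  using cinner_nonneg[of x] by (simp add: hnorm_def)

lemma hnorm_zero [simp]: "hnorm (0::'h::chilbert) = 0"
  by (simp add: hnorm_def)

lemma hnorm_eq_zero [simp]: "hnorm (x::'h::chilbert) = 0 \<longleftrightarrow> x = 0"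
proof
  assume "hnorm x = 0"
  then have "cinner x x = 0"
    by (simp add: cinner_same)
  then show "x = 0"
    by (rule cinner_zero)
qed simp

lemma hnorm_scaleC: "hnorm (scaleC a x) = cmod a * hnorm (x::'h::chilbert)"
proof -
  have "(hnorm (scaleC a x))\<^sup>2 = (cmod a * hnorm x)\<^sup>2"
    unfolding hnorm_sq cinner_scaleC_left cinner_scaleC_right power_mult_distrib cmod_power2
    by (simp add: cinner_same power2_eq_square algebra_simps)
  then show ?thesis
    by (simp add: power2_eq_iff_nonneg)
qed

lemma hnorm_minus [simp]: "hnorm (- x) = hnorm (x::'h::chilbert)"
  by (simp add: hnorm_def cinner_simps)

lemma hnorm_minus_commute: "hnorm (x - y) = hnorm (y - (x::'h::chilbert))"
  by (metis hnorm_minus minus_diff_eq)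

lemma hnorm_add_sq: "(hnorm (x + y))\<^sup>2 = (hnorm x)\<^sup>2 + 2 * Re (cinner x y) + (hnorm (y::'h::chilbert))\<^sup>2"
  by (simp add: hnorm_sq cinner_simps Re_cinner_commute[of y x])

lemma hnorm_diff_sq: "(hnorm (x - y))\<^sup>2 = (hnorm x)\<^sup>2 - 2 * Re (cinner x y) + (hnorm (y::'h::chilbert))\<^sup>2"
  by (simp add: hnorm_sq cinner_simps Re_cinner_commute[of y x])

lemma Re_cinner_le: "Re (cinner x y) \<le> hnorm x * hnorm (y::'h::chilbert)"
proof (cases "x = 0 \<or> y = 0")
  case False
  let ?a = "hnorm x" and ?b = "hnorm y"
  have pos: "?a > 0" "?b > 0"
    using False hnorm_ge_zero[of x] hnorm_ge_zero[of y] by (auto simp: less_le simp del: hnorm_ge_zero)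
  \<comment> \<open>Crosswise scaling gives both vectors the norm \<open>?a * ?b\<close>, so the
    expansion has the common positive factor \<open>2 * (?a * ?b)\<close>.\<close>
  have "0 \<le> (hnorm (scaleC (of_real ?b) x - scaleC (of_real ?a) y))\<^sup>2"
    by simp
  also have "\<dots> = 2 * (?a * ?b) * (?a * ?b - Re (cinner x y))"
    unfolding hnorm_diff_sq hnorm_scaleC cinner_simps
    by (simp add: power2_eq_square algebra_simps)
  finally show ?thesis
    using mult_pos_pos[OF pos] by (auto simp: zero_le_mult_iff)
qed auto

lemma cinner_bound: "cmod (cinner x y) \<le> hnorm x * hnorm (y::'h::chilbert)"
proof (cases "cinner x y = 0")
  case False
  \<comment> \<open>A unimodular phase that makes the inner product real and nonnegative, so that
    the bound on real parts suffices.\<close>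
  let ?c = "cnj (cinner x y) / of_real (cmod (cinner x y))"
  have "cnj (cinner x y) * cinner x y = of_real ((cmod (cinner x y))\<^sup>2)"
    by (metis complex_norm_square mult.commute)
  then have "cinner (scaleC ?c x) y = of_real (cmod (cinner x y))"
    using False by (simp add: cinner_simps power2_eq_square)
  moreover have "cmod ?c = 1"
    using False by (simp add: norm_divide)
  ultimately show ?thesis
    using Re_cinner_le[of "scaleC ?c x" y] by (simp add: hnorm_scaleC)
qed simp

lemma hnorm_triangle: "hnorm (x + y) \<le> hnorm x + hnorm (y::'h::chilbert)"
proof (rule power2_le_imp_le)
  show "(hnorm (x + y))\<^sup>2 \<le> (hnorm x + hnorm y)\<^sup>2"
    using Re_cinner_le[of x y] by (simp add: hnorm_add_sq power2_sum)
qed simp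

lemma hnorm_triangle_diff: "hnorm (x - z) \<le> hnorm (x - y) + hnorm (y - (z::'h::chilbert))"
  using hnorm_triangle[of "x - y" "y - z"] by simp

lemma parallelogram_law:
  "(hnorm (x + y))\<^sup>2 + (hnorm (x - y))\<^sup>2 = 2 * (hnorm x)\<^sup>2 + 2 * (hnorm (y::'h::chilbert))\<^sup>2"
  by (simp add: hnorm_add_sq hnorm_diff_sq)

lemma hnorm_add_sq_le: "(hnorm (x + y))\<^sup>2 \<le> 2 * (hnorm x)\<^sup>2 + 2 * (hnorm (y::'h::chilbert))\<^sup>2"
  using parallelogram_law[of x y] zero_le_power2[of "hnorm (x - y)"] by linarith

lemma cinner_eqI: "(\<And>z. cinner x z = cinner y z) \<Longrightarrow> x = (y::'h::chilbert)"
  using cinner_zero[of "x - y"] by (simp add: cinner_simps)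

lemma cinner_eqI_right: "(\<And>z. cinner z x = cinner z y) \<Longrightarrow> x = (y::'h::chilbert)"
  using cinner_zero[of "x - y"] by (simp add: cinner_simps)

section \<open>Limits of vectors\<close>

text \<open>The class \<open>chilbert\<close> carries no topology, so convergence of vectors is
  reduced to real convergence of \<open>hnorm\<close>. The filter is arbitrary in order to cover
  both sequences and nets over the monoid.\<close>

definition hlim :: "'i filter \<Rightarrow> ('i \<Rightarrow> 'h::chilbert) \<Rightarrow> 'h \<Rightarrow> bool" where
  "hlim F v l \<longleftrightarrow> ((\<lambda>i. hnorm (v i - l)) \<longlongrightarrow> 0) F"

lemma hlim_dominated:
  assumes "\<forall>\<^sub>F i in F. hnorm (v i - l) \<le> g i" "(g \<longlongrightarrow> 0) F"
  shows "hlim F v l"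
  unfolding hlim_def
  by (rule tendsto_sandwich[OF _ assms(1) tendsto_const assms(2)]) simp

lemma hlim_const: "hlim F (\<lambda>_. l) l"
  by (simp add: hlim_def)

lemma hlim_add:
  assumes "hlim F u a" "hlim F v b"
  shows "hlim F (\<lambda>i. u i + v i) (a + b)"
proof (rule hlim_dominated)
  have "hnorm (u i + v i - (a + b)) \<le> hnorm (u i - a) + hnorm (v i - b)" for i
    using hnorm_triangle[of "u i - a" "v i - b"] by (simp add: algebra_simps)
  then show "\<forall>\<^sub>F i in F. hnorm (u i + v i - (a + b)) \<le> hnorm (u i - a) + hnorm (v i - b)"
    by simp
  show "((\<lambda>i. hnorm (u i - a) + hnorm (v i - b)) \<longlongrightarrow> 0) F"
    using tendsto_add[OF assms[unfolded hlim_def]] by simp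
qed

lemma hlim_scaleC:
  assumes "hlim F v a"
  shows "hlim F (\<lambda>i. scaleC c (v i)) (scaleC c a)"
  using tendsto_mult_left[OF assms[unfolded hlim_def], of "cmod c"]
  by (simp add: hlim_def hnorm_scaleC flip: scaleC_diff_right)

lemma hlim_diff:
  assumes "hlim F u a" "hlim F v b"
  shows "hlim F (\<lambda>i. u i - v i) (a - b)"
  using hlim_add[OF assms(1) hlim_scaleC[OF assms(2), of "- 1"]] by (simp add: scaleC_minus1)

lemma hlim_cinner:
  assumes "hlim F v a"
  shows "((\<lambda>i. cinner (v i) w) \<longlongrightarrow> cinner a w) F"
proof (rule Lim_null[THEN iffD2], rule Lim_null_comparison)
  show "\<forall>\<^sub>F i in F. norm (cinner (v i) w - cinner a w) \<le> hnorm (v i - a) * hnorm w"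
    using cinner_bound[of _ w] by (simp add: flip: cinner_diff_left)
  show "((\<lambda>i. hnorm (v i - a) * hnorm w) \<longlongrightarrow> 0) F"
    using tendsto_mult_right[OF assms[unfolded hlim_def], of "hnorm w"] by simp
qed

lemma hlim_unique:
  assumes "F \<noteq> bot" "hlim F v a" "hlim F v b"
  shows "a = b"
  by (rule cinner_eqI) (rule tendsto_unique[OF assms(1) hlim_cinner[OF assms(2)] hlim_cinner[OF assms(3)]])

lemma hlim_hnorm:
  assumes "hlim F v a"
  shows "((\<lambda>i. hnorm (v i)) \<longlongrightarrow> hnorm a) F"
proof (rule Lim_null[THEN iffD2], rule Lim_null_comparison[OF _ assms[unfolded hlim_def]])
  have "\<bar>hnorm (v i) - hnorm a\<bar> \<le> hnorm (v i - a)" for i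
    using hnorm_triangle[of "v i - a" a] hnorm_triangle[of "a - v i" "v i"]
    by (simp add: hnorm_minus_commute[of a])
  then show "\<forall>\<^sub>F i in F. norm (hnorm (v i) - hnorm a) \<le> hnorm (v i - a)"
    by simp
qed

text \<open>The bound is split into one vanishing term per index because each use supplies it so:
  gaps to an infimum in \<open>riesz_representation\<close>, distances to a norm limit in
  \<open>fixed_mod_null_norm_closed\<close>, oscillations of tails in
  \<open>hlim_net_if_Cauchy\<close>.\<close>

lemma hlim_sequentially_if_Cauchy:
  fixes v :: "nat \<Rightarrow> 'h::chilbert"
  assumes le: "\<And>m n. hnorm (v m - v n) \<le> b m + b n" and b: "b \<longlonglongrightarrow> 0"
  shows "\<exists>l. hlim sequentially v l"
proof -
  have "\<exists>M::nat. \<forall>m\<ge>M. \<forall>n\<ge>M. sqrt (Re (cinner (v m - v n) (v m - v n))) < e" if "e > 0" for e :: real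
  proof -
    have "\<forall>\<^sub>F n in sequentially. b n < e / 2"
      by (rule order_tendstoD(2)[OF b]) (use that in simp)
    then obtain M where M: "\<And>n. n \<ge> M \<Longrightarrow> b n < e / 2"
      by (auto simp: eventually_sequentially)
    have "hnorm (v m - v n) < e" if "m \<ge> M" "n \<ge> M" for m n
      using le[of m n] M[OF that(1)] M[OF that(2)] by linarith
    then show ?thesis
      by (auto simp: hnorm_def)
  qed
  then obtain l where "\<forall>e>0. \<exists>M::nat. \<forall>n\<ge>M. sqrt (Re (cinner (v n - l) (v n - l))) < e"
    using hilbert_complete[of v] by blast
  then have "hlim sequentially v l"
    unfolding hlim_def by (auto simp: LIMSEQ_iff hnorm_def[symmetric])
  then show ?thesis ..
qed

section \<open>Bounded operators and adjoints\<close>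

lemma riesz_representation:
  fixes f :: "'h::chilbert \<Rightarrow> complex"
  assumes add: "\<And>x y. f (x + y) = f x + f y" and scale: "\<And>c x. f (scaleC c x) = c * f x"
    and bound: "\<And>x. cmod (f x) \<le> K * hnorm x"
  shows "\<exists>z. \<forall>x. f x = cinner x z"
proof -
  \<comment> \<open>The representing vector minimises \<open>\<parallel>x\<parallel>\<^sup>2 - 2 Re (f x)\<close>.\<close>
  define q where "q x = (hnorm x)\<^sup>2 - 2 * Re (f x)" for x
  have q_lower: "- K\<^sup>2 \<le> q x" for x
  proof -
    have "Re (f x) \<le> K * hnorm x"
      using bound[of x] complex_Re_le_cmod[of "f x"] by linarith
    moreover have "0 \<le> (hnorm x - K)\<^sup>2"
      by simp
    ultimately show ?thesis
      by (simp add: q_def power2_diff algebra_simps)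
  qed
  define I where "I = Inf (range q)"
  have bdd: "bdd_below (range q)"
    using q_lower by (auto intro!: bdd_belowI)
  have I_le: "I \<le> q x" for x
    unfolding I_def by (rule cInf_lower[OF _ bdd]) simp
  have "\<exists>x. q x < I + e" if "e > 0" for e
    using cInf_lessD[of "range q" "I + e"] that by (auto simp: I_def)
  then have "\<exists>x. q x < I + 1 / real (Suc n)" for n
    by simp
  then obtain v where v: "\<And>n. q (v n) < I + 1 / real (Suc n)"
    by metis
  have f_diff: "f (x - y) = f x - f y" for x y
    using add[of "x - y" y] by simp
  \<comment> \<open>The midpoint of \<open>x\<close> and \<open>y\<close> also has
    \<open>q\<close>-value at least \<open>I\<close>, so the parallelogram law bounds their distance
    by their gaps to the infimum. Minimising sequences are therefore Cauchy.\<close>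
  have step: "(hnorm (x - y))\<^sup>2 \<le> 2 * (q x - I) + 2 * (q y - I)" for x y
  proof -
    have "4 * q (scaleC (1/2) (x + y)) = (hnorm (x + y))\<^sup>2 - 4 * Re (f x) - 4 * Re (f y)"
      by (simp add: q_def hnorm_scaleC scale add power_divide field_simps)
    moreover have "I \<le> q (scaleC (1/2) (x + y))"
      by (rule I_le)
    ultimately show ?thesis
      using parallelogram_law[of x y] by (simp add: q_def)
  qed
  define b where "b n = sqrt (2 / real (Suc n))" for n
  have "hnorm (v m - v n) \<le> b m + b n" for m n
  proof -
    have "(hnorm (v m - v n))\<^sup>2 \<le> 2 / real (Suc m) + 2 / real (Suc n)"
      using step[of "v m" "v n"] v[of m] v[of n] by simp
    then have "hnorm (v m - v n) \<le> sqrt (2 / real (Suc m) + 2 / real (Suc n))"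
      by (rule real_le_rsqrt)
    also have "\<dots> \<le> b m + b n"
      unfolding b_def by (rule sqrt_add_le_add_sqrt) simp_all
    finally show ?thesis .
  qed
  moreover have "b \<longlonglongrightarrow> 0"
    unfolding b_def
    using tendsto_real_sqrt[OF tendsto_mult_left[OF LIMSEQ_inverse_real_of_nat, of 2]]
    by (simp add: divide_inverse)
  ultimately obtain z where z: "hlim sequentially v z"
    using hlim_sequentially_if_Cauchy by blast
  have "q z \<le> I"
  proof (rule tendsto_le[OF sequentially_bot])
    have "(\<lambda>n. f (v n)) \<longlonglongrightarrow> f z"
    proof (rule Lim_null[THEN iffD2], rule Lim_null_comparison)
      show "\<forall>\<^sub>F n in sequentially. norm (f (v n) - f z) \<le> K * hnorm (v n - z)"
        using bound by (simp flip: f_diff)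
      show "(\<lambda>n. K * hnorm (v n - z)) \<longlonglongrightarrow> 0"
        using tendsto_mult_left[OF z[unfolded hlim_def], of K] by simp
    qed
    then show "(\<lambda>n. q (v n)) \<longlonglongrightarrow> q z"
      unfolding q_def by (intro tendsto_intros hlim_hnorm[OF z])
    show "(\<lambda>n. I + 1 / real (Suc n)) \<longlonglongrightarrow> I"
      using tendsto_add[OF tendsto_const LIMSEQ_inverse_real_of_nat, of I] by (simp add: divide_inverse)
    show "\<forall>\<^sub>F n in sequentially. q (v n) \<le> I + 1 / real (Suc n)"
      using v by (simp add: less_imp_le)
  qed
  then have min: "q z \<le> q x" for x
    using I_le[of x] by linarith
  have Re_eq: "Re (cinner z x) = Re (f x)" for x
  proof -
    \<comment> \<open>First variation at the minimiser: the linear coefficient in \<open>t\<close>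
      must vanish, which is the real part of the representation.\<close>
    have ineq: "0 \<le> 2 * t * (Re (cinner z x) - Re (f x)) + t\<^sup>2 * (hnorm x)\<^sup>2" for t
      using min[of "z + scaleC (of_real t) x"]
      by (simp add: q_def hnorm_add_sq add scale hnorm_scaleC cinner_simps power_mult_distrib algebra_simps)
    define d where "d = Re (cinner z x) - Re (f x)"
    \<comment> \<open>The optimal \<open>t\<close> would divide by the squared norm of
      \<open>x\<close>; adding \<open>1\<close> keeps the divisor positive for \<open>x = 0\<close>
      as well.\<close>
    define h where "h = (hnorm x)\<^sup>2 + 1"
    have h: "h > 0"
      by (simp add: h_def add_nonneg_pos)
    have "0 \<le> 2 * (- d / h) * d + (- d / h)\<^sup>2 * (hnorm x)\<^sup>2"
      using ineq[of "- d / h"] by (simp add: d_def)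
    also have "\<dots> \<le> 2 * (- d / h) * d + (- d / h)\<^sup>2 * h"
      by (intro add_left_mono mult_left_mono) (auto simp: h_def)
    also have "\<dots> = - (d\<^sup>2 / h)"
      using h by (simp add: power2_eq_square field_simps)
    finally have "d\<^sup>2 \<le> 0"
      using h by (simp add: divide_le_0_iff)
    then show ?thesis
      by (simp add: d_def)
  qed
  have "f x = cinner x z" for x
  proof -
    have "Re (f x) = Re (cinner x z)"
      using Re_eq[of x] by (simp add: Re_cinner_commute)
    \<comment> \<open>Complex linearity recovers the imaginary part from the real part at
      \<open>\<i> x\<close>.\<close>
    moreover have "Im (f x) = Im (cinner x z)"
      using Re_eq[of "scaleC \<i> x"] Re_cinner_commute[of z "scaleC \<i> x"]
      by (simp add: scale cinner_scaleC_left)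
    ultimately show ?thesis
      by (simp add: complex_eq_iff)
  qed
  then show ?thesis
    by blast
qed

lemma bounded_op_add: "bounded_op T \<Longrightarrow> T (x + y) = T x + T y"
  by (simp add: bounded_op_def)

lemma bounded_op_scaleC: "bounded_op T \<Longrightarrow> T (scaleC c x) = scaleC c (T x)"
  by (simp add: bounded_op_def)

lemma bounded_op_zero: "bounded_op T \<Longrightarrow> T 0 = 0"
  using bounded_op_scaleC[of T 0 0] by simp

lemma bounded_op_minus: "bounded_op T \<Longrightarrow> T (- x) = - T x"
  using bounded_op_scaleC[of T "- 1" x] by (simp add: scaleC_minus1)

lemma bounded_op_diff: "bounded_op T \<Longrightarrow> T (x - y) = T x - T y"
  using bounded_op_add[of T x "- y"] by (simp add: bounded_op_minus)

lemmas bounded_op_simps = bounded_op_add bounded_op_scaleC bounded_op_zero bounded_op_minus bounded_op_diff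

lemma bounded_opI:
  assumes "\<And>x y. T (x + y) = T x + T y" "\<And>c x. T (scaleC c x) = scaleC c (T x)"
    and "\<And>x. hnorm (T x) \<le> K * hnorm x"
  shows "bounded_op T"
  using assms by (auto simp: bounded_op_def)

lemma bdd_above_opnorm:
  assumes "bounded_op T"
  shows "bdd_above {hnorm (T x) | x. hnorm x \<le> 1}"
proof -
  obtain K where K: "\<And>x. hnorm (T x) \<le> K * hnorm x"
    using assms by (auto simp: bounded_op_def)
  have "hnorm (T x) \<le> \<bar>K\<bar>" if "hnorm x \<le> 1" for x
  proof -
    have "K * hnorm x \<le> \<bar>K\<bar> * 1"
      by (rule mult_mono) (use that in auto)
    then show ?thesis
      using K[of x] by simp
  qed
  then show ?thesis
    by (auto intro!: bdd_aboveI[of _ "\<bar>K\<bar>"])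
qed

lemma hnorm_le_opnorm:
  assumes "bounded_op T"
  shows "hnorm (T x) \<le> opnorm T * hnorm x"
proof (cases "x = 0")
  case False
  then have pos: "hnorm x > 0"
    using hnorm_ge_zero[of x] by (auto simp: less_le simp del: hnorm_ge_zero)
  let ?y = "scaleC (of_real (1 / hnorm x)) x"
  have "hnorm (T ?y) \<le> opnorm T"
    unfolding opnorm_def
    by (rule cSup_upper[OF _ bdd_above_opnorm[OF assms]]) (use pos in \<open>auto simp: hnorm_scaleC norm_divide intro!: exI[of _ ?y]\<close>)
  then show ?thesis
    using pos by (simp add: bounded_op_scaleC[OF assms] hnorm_scaleC norm_divide field_simps)
qed (simp add: bounded_op_zero[OF assms])

lemma opnorm_le:
  assumes "\<And>x. hnorm (T x) \<le> K * hnorm x" "0 \<le> K"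
  shows "opnorm T \<le> K"
  unfolding opnorm_def
proof (rule cSup_least)
  show "{hnorm (T x) |x. hnorm x \<le> 1} \<noteq> {}"
    by (auto intro!: exI[of _ 0])
  fix r assume "r \<in> {hnorm (T x) |x. hnorm x \<le> 1}"
  then obtain x where "r = hnorm (T x)" "hnorm x \<le> 1"
    by blast
  then show "r \<le> K"
    using assms(1)[of x] mult_left_mono[of "hnorm x" 1 K] assms(2) by simp
qed

lemma opnorm_nonneg:
  assumes "bounded_op T"
  shows "0 \<le> opnorm T"
  unfolding opnorm_def
  by (rule cSup_upper[OF _ bdd_above_opnorm[OF assms]])
    (auto simp: bounded_op_zero[OF assms] intro!: exI[of _ 0])

lemma hlim_bounded_op:
  assumes "bounded_op T" "hlim F v a"
  shows "hlim F (\<lambda>i. T (v i)) (T a)"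
proof (rule hlim_dominated)
  show "\<forall>\<^sub>F i in F. hnorm (T (v i) - T a) \<le> opnorm T * hnorm (v i - a)"
    using hnorm_le_opnorm[OF assms(1)] by (simp flip: bounded_op_diff[OF assms(1)])
  show "((\<lambda>i. opnorm T * hnorm (v i - a)) \<longlongrightarrow> 0) F"
    using tendsto_mult_left[OF assms(2)[unfolded hlim_def], of "opnorm T"] by simp
qed

lemma op_add_apply: "op_add S T x = S x + T x"
  by (simp add: op_add_def)

lemma op_diff_apply: "op_diff S T x = S x - T x"
  by (simp add: op_diff_def)

lemma op_scale_apply: "op_scale c T x = scaleC c (T x)"
  by (simp add: op_scale_def)

lemma bounded_op_const_zero: "bounded_op (\<lambda>_. 0)"
  by (rule bounded_opI[where K = 0]) auto

lemma bounded_op_op_add: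
  assumes "bounded_op S" "bounded_op T"
  shows "bounded_op (op_add S T)"
proof (rule bounded_opI)
  show "hnorm (op_add S T x) \<le> (opnorm S + opnorm T) * hnorm x" for x
    using hnorm_triangle[of "S x" "T x"] hnorm_le_opnorm[OF assms(1), of x] hnorm_le_opnorm[OF assms(2), of x]
    by (simp add: op_add_def distrib_right)
qed (use assms in \<open>auto simp: op_add_def bounded_op_simps scaleC_add_right algebra_simps\<close>)

lemma bounded_op_op_scale:
  assumes "bounded_op T"
  shows "bounded_op (op_scale c T)"
proof (rule bounded_opI)
  show "hnorm (op_scale c T x) \<le> (cmod c * opnorm T) * hnorm x" for x
    using mult_left_mono[OF hnorm_le_opnorm[OF assms, of x], of "cmod c"]
    by (simp add: op_scale_def hnorm_scaleC mult.assoc)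
qed (use assms in \<open>auto simp: op_scale_def bounded_op_simps scaleC_add_right scaleC_scaleC mult.commute\<close>)

lemma op_diff_eq: "op_diff S T = op_add S (op_scale (- 1) T)"
  by (simp add: op_diff_def op_add_def op_scale_def scaleC_minus1)

lemma bounded_op_op_diff: "bounded_op S \<Longrightarrow> bounded_op T \<Longrightarrow> bounded_op (op_diff S T)"
  by (simp add: op_diff_eq bounded_op_op_add bounded_op_op_scale)

lemma bounded_op_id: "bounded_op (\<lambda>x. x)"
  by (rule bounded_opI[where K = 1]) auto

lemma hnorm_comp_le:
  assumes "bounded_op S" "bounded_op T"
  shows "hnorm (S (T x)) \<le> (opnorm S * opnorm T) * hnorm x"
  using hnorm_le_opnorm[OF assms(1), of "T x"]
    mult_left_mono[OF hnorm_le_opnorm[OF assms(2), of x] opnorm_nonneg[OF assms(1)]]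
  by (simp add: mult.assoc)

lemma bounded_op_comp:
  assumes "bounded_op S" "bounded_op T"
  shows "bounded_op (S \<circ> T)"
proof (rule bounded_opI)
  show "hnorm ((S \<circ> T) x) \<le> (opnorm S * opnorm T) * hnorm x" for x
    using hnorm_comp_le[OF assms] by simp
qed (use assms in \<open>auto simp: bounded_op_simps\<close>)

lemma opnorm_comp_le:
  assumes "bounded_op S" "bounded_op T"
  shows "opnorm (S \<circ> T) \<le> opnorm S * opnorm T"
  by (rule opnorm_le) (auto simp: hnorm_comp_le opnorm_nonneg assms)

lemma opnorm_triangle:
  assumes "bounded_op S" "bounded_op T"
  shows "opnorm (op_add S T) \<le> opnorm S + opnorm T"
proof (rule opnorm_le)
  show "hnorm (op_add S T x) \<le> (opnorm S + opnorm T) * hnorm x" for x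
    using hnorm_triangle[of "S x" "T x"] hnorm_le_opnorm[OF assms(1), of x] hnorm_le_opnorm[OF assms(2), of x]
    by (simp add: op_add_def distrib_right)
qed (simp add: add_nonneg_nonneg opnorm_nonneg assms)

lemma opnorm_op_diff_commute: "opnorm (op_diff S T) = opnorm (op_diff T S)"
  by (simp add: opnorm_def op_diff_def hnorm_minus_commute)

lemma opnorm_diff_triangle:
  assumes "bounded_op R" "bounded_op S" "bounded_op T"
  shows "opnorm (op_diff R T) \<le> opnorm (op_diff R S) + opnorm (op_diff S T)"
proof -
  have "op_diff R T = op_add (op_diff R S) (op_diff S T)"
    by (simp add: op_diff_def op_add_def)
  then show ?thesis
    using opnorm_triangle[OF bounded_op_op_diff bounded_op_op_diff] assms by metis
qed

lemma adjoint_eqI: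
  assumes "\<And>x y. cinner (T x) y = cinner x (S y)"
  shows "adjoint T = S"
  unfolding adjoint_def
proof (rule the_equality)
  show "\<forall>x y. cinner (T x) y = cinner x (S y)"
    using assms by blast
next
  fix R assume R: "\<forall>x y. cinner (T x) y = cinner x (R y)"
  show "R = S"
  proof (intro ext cinner_eqI_right)
    show "cinner z (R y) = cinner z (S y)" for y z
      using R assms by metis
  qed
qed

text \<open>\<open>adjoint\<close> is a definite description, so an operator satisfying it must
  first be produced; Riesz representation of \<open>x \<mapsto> cinner (T x) y\<close> gives its
  value at \<open>y\<close>.\<close>

lemma cinner_adjoint:
  assumes T: "bounded_op T"
  shows "cinner (T x) y = cinner x (adjoint T y)"
proof -
  have "\<exists>z. \<forall>x. cinner (T x) y = cinner x z" for y
  proof (rule riesz_representation)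
    show "cmod (cinner (T x) y) \<le> (opnorm T * hnorm y) * hnorm x" for x
      using cinner_bound[of "T x" y] mult_right_mono[OF hnorm_le_opnorm[OF T, of x], of "hnorm y"]
      by (simp add: algebra_simps)
  qed (use T in \<open>simp_all add: bounded_op_simps cinner_simps\<close>)
  then obtain S where S: "\<And>x y. cinner (T x) y = cinner x (S y)"
    by metis
  have "adjoint T = S"
    by (rule adjoint_eqI) (rule S)
  with S show ?thesis
    by simp
qed

lemma cinner_adjoint':
  assumes "bounded_op T"
  shows "cinner (adjoint T x) y = cinner x (T y)"
  by (subst (1 2) cinner_commute) (simp add: cinner_adjoint[OF assms])

lemma hnorm_adjoint_le:
  assumes "bounded_op T"
  shows "hnorm (adjoint T x) \<le> opnorm T * hnorm x"
proof (cases "adjoint T x = 0")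
  case True
  then show ?thesis
    by (simp add: opnorm_nonneg assms)
next
  case False
  let ?y = "adjoint T x"
  have pos: "hnorm ?y > 0"
    using False hnorm_ge_zero[of ?y] by (auto simp: less_le simp del: hnorm_ge_zero)
  have "(hnorm ?y)\<^sup>2 = Re (cinner (T ?y) x)"
    by (simp add: hnorm_sq cinner_adjoint[OF assms])
  also have "\<dots> \<le> (opnorm T * hnorm ?y) * hnorm x"
    using Re_cinner_le[of "T ?y" x] mult_right_mono[OF hnorm_le_opnorm[OF assms, of ?y], of "hnorm x"]
    by simp
  finally show ?thesis
    using pos by (simp add: power2_eq_square)
qed

lemma bounded_op_adjoint:
  assumes "bounded_op T"
  shows "bounded_op (adjoint T)"
proof (rule bounded_opI[OF _ _ hnorm_adjoint_le[OF assms]])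
  show "adjoint T (x + y) = adjoint T x + adjoint T y" for x y
    by (rule cinner_eqI) (simp add: cinner_adjoint'[OF assms] cinner_simps)
  show "adjoint T (scaleC c x) = scaleC c (adjoint T x)" for c x
    by (rule cinner_eqI) (simp add: cinner_adjoint'[OF assms] cinner_simps)
qed

lemma opnorm_adjoint_le: "bounded_op T \<Longrightarrow> opnorm (adjoint T) \<le> opnorm T"
  by (rule opnorm_le) (auto simp: hnorm_adjoint_le opnorm_nonneg)

lemma adjoint_involution: "bounded_op T \<Longrightarrow> adjoint (adjoint T) = T"
  by (rule adjoint_eqI) (rule cinner_adjoint')

lemma adjoint_op_add:
  "bounded_op S \<Longrightarrow> bounded_op T \<Longrightarrow> adjoint (op_add S T) = op_add (adjoint S) (adjoint T)"
  by (rule adjoint_eqI) (simp add: op_add_def cinner_simps cinner_adjoint)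

lemma adjoint_op_diff:
  "bounded_op S \<Longrightarrow> bounded_op T \<Longrightarrow> adjoint (op_diff S T) = op_diff (adjoint S) (adjoint T)"
  by (rule adjoint_eqI) (simp add: op_diff_def cinner_simps cinner_adjoint)

lemma adjoint_op_scale: "bounded_op T \<Longrightarrow> adjoint (op_scale c T) = op_scale (cnj c) (adjoint T)"
  by (rule adjoint_eqI) (simp add: op_scale_def cinner_simps cinner_adjoint)

lemma adjoint_comp: "bounded_op S \<Longrightarrow> bounded_op T \<Longrightarrow> adjoint (S \<circ> T) = adjoint T \<circ> adjoint S"
  by (rule adjoint_eqI) (simp add: cinner_adjoint)

section \<open>Positive operators\<close>

definition pos_op :: "('h::chilbert \<Rightarrow> 'h) \<Rightarrow> bool" where
  "pos_op T \<longleftrightarrow> (\<forall>x. Im (cinner (T x) x) = 0 \<and> 0 \<le> Re (cinner (T x) x))"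

text \<open>Polarization: reality of the form at \<open>x + y\<close> and at
  \<open>x + \<i> y\<close> fixes the imaginary and the real part of the off-diagonal value.\<close>

lemma pos_op_symmetric:
  assumes T: "bounded_op T" and pos: "pos_op T"
  shows "cinner (T x) y = cinner x (T y)"
proof -
  have im: "Im (cinner (T z) z) = 0" for z
    using pos by (simp add: pos_op_def)
  have "Im (cinner (T x) y) = - Im (cinner (T y) x)"
    using im[of "x + y"] im[of x] im[of y] by (simp add: bounded_op_simps[OF T] cinner_simps)
  moreover have "Re (cinner (T x) y) = Re (cinner (T y) x)"
    using im[of "x + scaleC \<i> y"] im[of x] im[of y] by (simp add: bounded_op_simps[OF T] cinner_simps)
  ultimately have "cinner (T x) y = cnj (cinner (T y) x)"
    by (simp add: complex_eq_iff)
  then show ?thesis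
    using cinner_commute[of x "T y"] by simp
qed

text \<open>This is \<open>T\<^sup>2 \<le> K T\<close> for \<open>0 \<le> T \<le> K\<close>. It
  upgrades convergence of quadratic forms to strong convergence, and later bounds the square of a
  positive operator by the operator itself.\<close>

lemma pos_op_hnorm_sq_le:
  assumes T: "bounded_op T" and pos: "pos_op T" and K: "K > 0" "\<And>x. hnorm (T x) \<le> K * hnorm x"
  shows "(hnorm (T x))\<^sup>2 \<le> K * Re (cinner (T x) x)"
proof -
  \<comment> \<open>Evaluate the positive form of \<open>T\<close> at \<open>x - T x / K\<close>.\<close>
  let ?t = "1 / K"
  let ?n = "(hnorm (T x))\<^sup>2"
  let ?z = "x - scaleC (of_real ?t) (T x)"
  have "0 \<le> Re (cinner (T ?z) ?z)"
    using pos by (simp add: pos_op_def)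
  also have "\<dots> = Re (cinner (T x) x) - 2 * ?t * ?n + ?t\<^sup>2 * Re (cinner (T (T x)) (T x))"
    unfolding bounded_op_simps[OF T] cinner_simps hnorm_sq pos_op_symmetric[OF T pos, of "T x" x]
    by (simp add: power2_eq_square algebra_simps)
  also have "\<dots> \<le> Re (cinner (T x) x) - 2 * ?t * ?n + ?t\<^sup>2 * (K * ?n)"
  proof -
    have "Re (cinner (T (T x)) (T x)) \<le> K * ?n"
      using Re_cinner_le[of "T (T x)" "T x"] mult_right_mono[OF K(2)[of "T x"], of "hnorm (T x)"]
      by (simp add: power2_eq_square)
    then show ?thesis
      by (intro add_left_mono mult_left_mono) auto
  qed
  also have "\<dots> = Re (cinner (T x) x) - ?n / K"
    using K(1) by (simp add: power2_eq_square field_simps)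
  finally show ?thesis
    using K(1) by (simp add: field_simps)
qed

section \<open>Von Neumann algebras\<close>

lemma commutant_iff: "T \<in> commutant A \<longleftrightarrow> bounded_op T \<and> (\<forall>a\<in>A. \<forall>x. T (a x) = a (T x))"
  by (auto simp: commutant_def fun_eq_iff)

text \<open>Commutation with \<open>a\<close> survives a strong limit because \<open>a\<close> is
  continuous, and the uniform bound keeps the limit bounded. Applied to the double commutant, this
  closes a von Neumann algebra under bounded strong limits.\<close>

lemma commutant_hlim:
  assumes A: "A \<subseteq> Collect bounded_op" and F: "F \<noteq> bot" and T: "\<And>i. T i \<in> commutant A"
    and bound: "\<And>i x. hnorm (T i x) \<le> K * hnorm x" and lim: "\<And>x. hlim F (\<lambda>i. T i x) (L x)"
  shows "L \<in> commutant A"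
  unfolding commutant_iff
proof (intro conjI ballI allI)
  have T_bdd: "bounded_op (T i)" for i
    using T by (simp add: commutant_iff)
  show "bounded_op L"
  proof (rule bounded_opI)
    show "L (x + y) = L x + L y" for x y
      using hlim_unique[OF F lim[of "x + y"]] hlim_add[OF lim[of x] lim[of y]]
      by (simp add: bounded_op_simps[OF T_bdd])
    show "L (scaleC c x) = scaleC c (L x)" for c x
      using hlim_unique[OF F lim[of "scaleC c x"]] hlim_scaleC[OF lim[of x]]
      by (simp add: bounded_op_simps[OF T_bdd])
    show "hnorm (L x) \<le> K * hnorm x" for x
      by (rule tendsto_upperbound[OF hlim_hnorm[OF lim] _ F]) (simp add: bound)
  qed
  show "L (a x) = a (L x)" if a: "a \<in> A" for a x
  proof (rule hlim_unique[OF F lim])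
    have "hlim F (\<lambda>i. a (T i x)) (a (L x))"
      by (rule hlim_bounded_op[OF _ lim]) (use a A in auto)
    then show "hlim F (\<lambda>i. T i (a x)) (a (L x))"
      using a T by (simp add: commutant_iff)
  qed
qed

locale vN_algebra =
  fixes N :: "('h::chilbert \<Rightarrow> 'h) set"
  assumes vN: "von_neumann_algebra N"
begin

lemma bicommutant: "N = commutant (commutant N)"
  using vN by (simp add: von_neumann_algebra_def)

lemma commutant_bounded: "commutant N \<subseteq> Collect bounded_op"
  by (auto simp: commutant_iff)

lemma N_bounded: "x \<in> N \<Longrightarrow> bounded_op x"
  using vN by (auto simp: von_neumann_algebra_def)

lemma N_adjoint: "x \<in> N \<Longrightarrow> adjoint x \<in> N"
  using vN by (auto simp: von_neumann_algebra_def)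

lemma N_id: "(\<lambda>x. x) \<in> N"
  by (subst bicommutant) (simp add: commutant_iff bounded_op_id)

lemma N_zero: "(\<lambda>x. 0) \<in> N"
  by (subst bicommutant) (auto simp: commutant_iff bounded_op_const_zero bounded_op_zero)

lemma N_op_add:
  assumes "x \<in> N" "y \<in> N"
  shows "op_add x y \<in> N"
proof -
  have "op_add x y \<in> commutant (commutant N)"
    using assms unfolding bicommutant[THEN eqset_imp_iff] commutant_iff[of _ "commutant N"]
    by (auto simp: bounded_op_op_add) (auto simp: op_add_def commutant_iff bounded_op_simps)
  then show ?thesis
    by (subst bicommutant)
qed

lemma N_op_scale:
  assumes "x \<in> N"
  shows "op_scale c x \<in> N"
proof -
  have "op_scale c x \<in> commutant (commutant N)"
    using assms unfolding bicommutant[THEN eqset_imp_iff] commutant_iff[of _ "commutant N"]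
    by (auto simp: bounded_op_op_scale) (auto simp: op_scale_def commutant_iff bounded_op_simps)
  then show ?thesis
    by (subst bicommutant)
qed

lemma N_op_diff: "x \<in> N \<Longrightarrow> y \<in> N \<Longrightarrow> op_diff x y \<in> N"
  by (simp add: op_diff_eq N_op_add N_op_scale)

lemma N_comp:
  assumes "x \<in> N" "y \<in> N"
  shows "x \<circ> y \<in> N"
proof -
  have "x \<circ> y \<in> commutant (commutant N)"
    using assms unfolding bicommutant[THEN eqset_imp_iff] commutant_iff[of _ "commutant N"]
    by (auto simp: bounded_op_comp)
  then show ?thesis
    by (subst bicommutant)
qed

lemma N_hlim:
  assumes "F \<noteq> bot" "\<And>i. T i \<in> N" "\<And>i x. hnorm (T i x) \<le> K * hnorm x"
    and "\<And>x. hlim F (\<lambda>i. T i x) (L x)"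
  shows "L \<in> N"
  using commutant_hlim[OF commutant_bounded assms(1) _ assms(3,4)] assms(2) bicommutant by simp

end

section \<open>Contractive completely positive maps\<close>

abbreviation abs_sq :: "('h::chilbert \<Rightarrow> 'h) \<Rightarrow> 'h \<Rightarrow> 'h" where
  "abs_sq x \<equiv> adjoint x \<circ> x"

lemma cinner_abs_sq: "bounded_op x \<Longrightarrow> cinner (abs_sq x v) v = complex_of_real ((hnorm (x v))\<^sup>2)"
  by (simp add: cinner_adjoint' cinner_same)

locale cp_contraction = vN_algebra N for N :: "('h::chilbert \<Rightarrow> 'h) set" +
  fixes f :: "('h \<Rightarrow> 'h) \<Rightarrow> ('h \<Rightarrow> 'h)"
  assumes f_N: "\<And>x. x \<in> N \<Longrightarrow> f x \<in> N"
    and cp: "completely_positive N f"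
    and contr: "contractive N f"
begin

lemma f_op_add: "x \<in> N \<Longrightarrow> y \<in> N \<Longrightarrow> f (op_add x y) = op_add (f x) (f y)"
  using cp by (simp add: completely_positive_def linear_on_def)

lemma f_op_scale: "x \<in> N \<Longrightarrow> f (op_scale c x) = op_scale c (f x)"
  using cp by (simp add: completely_positive_def linear_on_def)

lemma f_op_diff: "x \<in> N \<Longrightarrow> y \<in> N \<Longrightarrow> f (op_diff x y) = op_diff (f x) (f y)"
  by (simp add: op_diff_eq f_op_add f_op_scale N_op_scale)

lemma f_bounded: "x \<in> N \<Longrightarrow> bounded_op (f x)"
  by (simp add: f_N N_bounded)

lemma f_opnorm_le: "x \<in> N \<Longrightarrow> opnorm (f x) \<le> opnorm x"
  using contr by (simp add: contractive_def)

lemma f_hnorm_le: "x \<in> N \<Longrightarrow> hnorm (f x v) \<le> opnorm x * hnorm v"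
  using hnorm_le_opnorm[OF f_bounded, of x v] mult_right_mono[OF f_opnorm_le, of x "hnorm v"]
  by simp

lemma f_pos_matrix:
  "(\<And>i j. i < n \<Longrightarrow> j < n \<Longrightarrow> X i j \<in> N) \<Longrightarrow> pos_matrix n X \<Longrightarrow> pos_matrix n (\<lambda>i j. f (X i j))"
  using cp by (simp add: completely_positive_def)

lemma f_pos:
  assumes "x \<in> N" "pos_op x"
  shows "pos_op (f x)"
proof -
  have "pos_matrix 1 (\<lambda>_ _. x)"
    using assms(2) by (simp add: pos_matrix_def pos_op_def Let_def)
  then have "pos_matrix 1 (\<lambda>_ _. f x)"
    using f_pos_matrix[of 1 "\<lambda>_ _. x"] assms(1) by simp
  then have "Im (cinner (f x v) v) = 0 \<and> 0 \<le> Re (cinner (f x v) v)" for v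
    unfolding pos_matrix_def Let_def by (drule_tac x = "\<lambda>_. v" in spec) simp
  then show ?thesis
    by (simp add: pos_op_def)
qed

lemma f_mono:
  assumes "x \<in> N" "y \<in> N" "pos_op (op_diff y x)"
  shows "Re (cinner (f x v) v) \<le> Re (cinner (f y v) v)"
proof -
  have "pos_op (op_diff (f y) (f x))"
    using f_pos[OF N_op_diff assms(3)] assms(1,2) by (simp add: f_op_diff)
  then show ?thesis
    by (simp add: pos_op_def op_diff_def cinner_simps)
qed

text \<open>The matrix with rows \<open>1, x\<close> and \<open>x\<^sup>*, x\<^sup>* x\<close> is
  positive since its form is the squared norm of \<open>u + x v\<close>. Its image under
  \<open>f\<close> yields both compatibility with adjoints and the Schwarz inequality.\<close>

lemma f_pos_matrix2:
  assumes x: "x \<in> N"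
  defines "q \<equiv> \<lambda>u v. cinner (f (\<lambda>z. z) u) u + cinner (f x v) u
    + (cinner (f (adjoint x) u) v + cinner (f (abs_sq x) v) v)"
  shows "Im (q u v) = 0" "0 \<le> Re (q u v)"
proof -
  define X where "X i j = (if i = (0::nat) then (if j = (0::nat) then (\<lambda>z. z) else x)
    else (if j = 0 then adjoint x else abs_sq x))" for i j
  have X_N: "X i j \<in> N" for i j
    using x by (auto simp: X_def N_id N_adjoint N_comp)
  have "pos_matrix 2 X"
    unfolding pos_matrix_def Let_def
  proof
    fix \<xi> :: "nat \<Rightarrow> 'h"
    have "(\<Sum>i<2. \<Sum>j<2. cinner (X i j (\<xi> j)) (\<xi> i)) = cinner (\<xi> 0 + x (\<xi> 1)) (\<xi> 0 + x (\<xi> 1))"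
      by (simp add: numeral_2_eq_2 X_def cinner_simps cinner_adjoint'[OF N_bounded[OF x]])
    then show "Im (\<Sum>i<2. \<Sum>j<2. cinner (X i j (\<xi> j)) (\<xi> i)) = 0 \<and>
        0 \<le> Re (\<Sum>i<2. \<Sum>j<2. cinner (X i j (\<xi> j)) (\<xi> i))"
      by (simp add: cinner_same)
  qed
  then have "pos_matrix 2 (\<lambda>i j. f (X i j))"
    using f_pos_matrix X_N by blast
  then have "Im (\<Sum>i<2. \<Sum>j<2. cinner (f (X i j) (\<xi> j)) (\<xi> i)) = 0 \<and>
        0 \<le> Re (\<Sum>i<2. \<Sum>j<2. cinner (f (X i j) (\<xi> j)) (\<xi> i))" for \<xi>
    unfolding pos_matrix_def Let_def by blast
  from this[of "\<lambda>i. if i = 0 then u else v"]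
  show "Im (q u v) = 0" "0 \<le> Re (q u v)"
    by (simp_all add: q_def numeral_2_eq_2 X_def)
qed

lemma pos_op_id: "pos_op (\<lambda>z. z)"
  by (simp add: pos_op_def cinner_same)

text \<open>The diagonal terms of the two-by-two form are real, so the imaginary parts of the
  off-diagonal terms cancel; replacing \<open>v\<close> by \<open>\<i> v\<close> turns this into the
  statement on real parts.\<close>

lemma f_adjoint_cinner:
  assumes x: "x \<in> N"
  shows "cinner (f x v) u = cinner v (f (adjoint x) u)"
proof -
  have im1: "Im (cinner (f (\<lambda>z. z) u) u) = 0" for u
    using f_pos[OF N_id pos_op_id] by (simp add: pos_op_def)
  have "pos_op (abs_sq x)"
    using N_bounded[OF x] by (simp add: pos_op_def cinner_adjoint' cinner_same)
  then have im2: "Im (cinner (f (abs_sq x) u) u) = 0" for u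
    using f_pos[of "abs_sq x"] x by (simp add: pos_op_def N_comp N_adjoint)
  have im: "Im (cinner (f x v) u) = - Im (cinner (f (adjoint x) u) v)" for u v
    using f_pos_matrix2(1)[OF x, of u v] im1 im2 by simp
  have "Re (cinner (f x v) u) = Re (cinner (f (adjoint x) u) v)"
    using im[of "scaleC \<i> v" u] x by (simp add: bounded_op_simps f_bounded N_adjoint cinner_simps)
  with im[of v u] have "cinner (f x v) u = cnj (cinner (f (adjoint x) u) v)"
    by (simp add: complex_eq_iff)
  then show ?thesis
    using cinner_commute[of v "f (adjoint x) u"] by simp
qed

lemma adjoint_f: "x \<in> N \<Longrightarrow> adjoint (f x) = f (adjoint x)"
  by (rule adjoint_eqI) (rule f_adjoint_cinner)

lemma f_id_le: "Re (cinner (f (\<lambda>z. z) v) v) \<le> (hnorm v)\<^sup>2"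
proof -
  \<comment> \<open>Only an inequality is claimed: on the zero space the identity has norm
    \<open>0\<close>.\<close>
  have "opnorm (\<lambda>z::'h. z) \<le> 1"
    by (rule opnorm_le) auto
  then have "hnorm (f (\<lambda>z. z) v) \<le> hnorm v"
    using f_hnorm_le[OF N_id, of v] mult_right_mono[of "opnorm (\<lambda>z::'h. z)" 1 "hnorm v"] by simp
  then show ?thesis
    using Re_cinner_le[of "f (\<lambda>z. z) v" v] mult_right_mono[of _ "hnorm v" "hnorm v"]
    by (force simp: power2_eq_square)
qed

text \<open>Put \<open>u = - f x v\<close> in the two-by-two form. The cross terms contribute minus
  twice the squared norm of \<open>f x v\<close>, and the corner \<open>f 1 \<le> 1\<close> gives
  back at most one of the two.\<close>

lemma kadison_schwarz:
  assumes x: "x \<in> N"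
  shows "(hnorm (f x v))\<^sup>2 \<le> Re (cinner (f (abs_sq x) v) v)"
proof -
  let ?u = "- f x v"
  have "0 \<le> Re (cinner (f (\<lambda>z. z) ?u) ?u) - (hnorm (f x v))\<^sup>2 - (hnorm (f x v))\<^sup>2
      + Re (cinner (f (abs_sq x) v) v)"
    using f_pos_matrix2(2)[OF x, of ?u v]
    by (simp add: cinner_simps hnorm_sq bounded_op_simps f_bounded N_adjoint x
        f_adjoint_cinner[OF x] Re_cinner_commute[of "f (adjoint x) _" v])
  then show ?thesis
    using f_id_le[of ?u] by simp
qed

text \<open>Turns a pointwise norm estimate on \<open>d\<close> into a bound for
  \<open>f (d\<^sup>* d)\<close>, so that the ideal properties can be read off from elementary
  vector inequalities.\<close>

lemma f_abs_sq_le: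
  assumes d: "d \<in> N" and x: "x \<in> N" "\<And>u. Im (cinner (x u) u) = 0"
    and le: "\<And>u. (hnorm (d u))\<^sup>2 \<le> Re (cinner (x u) u)"
  shows "Re (cinner (f (abs_sq d) v) v) \<le> Re (cinner (f x v) v)"
proof (rule f_mono)
  show "pos_op (op_diff x (abs_sq d))"
    unfolding pos_op_def op_diff_def cinner_diff_left cinner_abs_sq[OF N_bounded[OF d]]
    using x le by simp
qed (use d x in \<open>auto simp: N_comp N_adjoint\<close>)

lemma f_abs_sq_nonneg: "x \<in> N \<Longrightarrow> 0 \<le> Re (cinner (f (abs_sq x) v) v)"
  using kadison_schwarz[of x v] zero_le_power2[of "hnorm (f x v)"] by linarith

lemma f_abs_sq_add_le:
  assumes d: "d \<in> N" "e \<in> N"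
  shows "Re (cinner (f (abs_sq (op_add d e)) v) v)
    \<le> 2 * Re (cinner (f (abs_sq d) v) v) + 2 * Re (cinner (f (abs_sq e) v) v)"
proof -
  let ?x = "op_add (op_scale 2 (abs_sq d)) (op_scale 2 (abs_sq e))"
  have sq: "abs_sq d \<in> N" "abs_sq e \<in> N"
    using d by (auto simp: N_comp N_adjoint)
  have form: "cinner (?x u) u = complex_of_real (2 * (hnorm (d u))\<^sup>2 + 2 * (hnorm (e u))\<^sup>2)" for u
    unfolding op_add_def op_scale_def cinner_add_left cinner_scaleC_left
      cinner_abs_sq[OF N_bounded[OF d(1)]] cinner_abs_sq[OF N_bounded[OF d(2)]] by simp
  have "Re (cinner (f (abs_sq (op_add d e)) v) v) \<le> Re (cinner (f ?x v) v)"
  proof (rule f_abs_sq_le)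
    show "(hnorm (op_add d e u))\<^sup>2 \<le> Re (cinner (?x u) u)" for u
      using hnorm_add_sq_le[of "d u" "e u"] unfolding form by (simp add: op_add_def)
    show "Im (cinner (?x u) u) = 0" for u
      unfolding form by simp
  qed (use d sq in \<open>auto simp: N_op_add N_op_scale\<close>)
  also have "\<dots> = 2 * Re (cinner (f (abs_sq d) v) v) + 2 * Re (cinner (f (abs_sq e) v) v)"
    by (simp add: f_op_add f_op_scale N_op_scale sq) (simp add: op_add_def op_scale_def cinner_simps)
  finally show ?thesis .
qed

text \<open>The source of the left ideal property: applying \<open>z\<close> after \<open>d\<close>
  costs at most the factor \<open>opnorm z\<close> at each vector.\<close>

lemma f_abs_sq_comp_le:
  assumes "z \<in> N" "d \<in> N"
  shows "Re (cinner (f (abs_sq (z \<circ> d)) v) v) \<le> (opnorm z)\<^sup>2 * Re (cinner (f (abs_sq d) v) v)"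
proof -
  let ?x = "op_scale (of_real ((opnorm z)\<^sup>2)) (abs_sq d)"
  have sq: "abs_sq d \<in> N"
    using assms by (auto simp: N_comp N_adjoint)
  have form: "cinner (?x u) u = complex_of_real ((opnorm z)\<^sup>2 * (hnorm (d u))\<^sup>2)" for u
    unfolding op_scale_def cinner_scaleC_left cinner_abs_sq[OF N_bounded[OF assms(2)]] by simp
  have "Re (cinner (f (abs_sq (z \<circ> d)) v) v) \<le> Re (cinner (f ?x v) v)"
  proof (rule f_abs_sq_le)
    show "(hnorm ((z \<circ> d) u))\<^sup>2 \<le> Re (cinner (?x u) u)" for u
      using power_mono[OF hnorm_le_opnorm[OF N_bounded[OF assms(1)], of "d u"], of 2] unfolding form
      by (simp add: power_mult_distrib)
    show "Im (cinner (?x u) u) = 0" for u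
      unfolding form by simp
  qed (use assms sq in \<open>auto simp: N_comp N_op_scale\<close>)
  also have "\<dots> = (opnorm z)\<^sup>2 * Re (cinner (f (abs_sq d) v) v)"
    by (simp add: f_op_scale sq) (simp add: op_scale_def cinner_simps)
  finally show ?thesis .
qed

lemma f_abs_sq_le_opnorm:
  assumes "d \<in> N"
  shows "Re (cinner (f (abs_sq d) v) v) \<le> (opnorm d)\<^sup>2 * (hnorm v)\<^sup>2"
proof -
  have "adjoint (\<lambda>z::'h. z) = (\<lambda>z. z)"
    by (rule adjoint_eqI) simp
  \<comment> \<open>Here \<open>d\<close> is read as \<open>d\<close> after the identity, so the
    bound for compositions applies with \<open>d\<close> as the left factor.\<close>
  then have "Re (cinner (f (abs_sq d) v) v) \<le> (opnorm d)\<^sup>2 * Re (cinner (f (\<lambda>z. z) v) v)"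
    using f_abs_sq_comp_le[OF assms N_id, of v] by (simp add: comp_def)
  also have "\<dots> \<le> (opnorm d)\<^sup>2 * (hnorm v)\<^sup>2"
    by (intro mult_left_mono f_id_le) simp
  finally show ?thesis .
qed

end

section \<open>Nets indexed by a commutative monoid\<close>

text \<open>In the preorder where \<open>t\<close> lies above \<open>s\<close> iff
  \<open>t = s + r\<close> for some \<open>r\<close>, \<open>range ((+) s)\<close> is the tail above
  \<open>s\<close>. These tails form a filter base because the tail of \<open>a + b\<close> lies in
  those of \<open>a\<close> and \<open>b\<close>.\<close>

definition monoid_at_top :: "'s::comm_monoid_add filter" where
  "monoid_at_top = (INF s. principal (range ((+) s)))"

lemma eventually_monoid_at_top:
  "eventually P monoid_at_top \<longleftrightarrow> (\<exists>s::'s::comm_monoid_add. \<forall>r. P (s + r))"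
  unfolding monoid_at_top_def
proof (subst eventually_INF_base)
  fix a b :: 's
  have "range ((+) (a + b)) \<subseteq> range ((+) a) \<inter> range ((+) b)"
    by (auto simp: add.assoc) (metis add.assoc add.commute rangeI)
  then show "\<exists>x\<in>UNIV. principal (range ((+) x)) \<le> inf (principal (range ((+) a))) (principal (range ((+) b)))"
    by auto
qed (auto simp: eventually_principal)

lemma monoid_at_top_neq_bot [simp]: "monoid_at_top \<noteq> (bot :: 's::comm_monoid_add filter)"
  unfolding trivial_limit_def eventually_monoid_at_top by simp

text \<open>By commutativity \<open>t + (s + r)\<close> still lies above \<open>s\<close>, so
  translating a net leaves its limit unchanged. Limits of orbits are fixed for this reason.\<close>

lemma filterlim_add_monoid_at_top: "filterlim ((+) t) monoid_at_top monoid_at_top"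
  for t :: "'s::comm_monoid_add"
  unfolding filterlim_iff eventually_monoid_at_top by (metis add.left_commute)

lemma sot_net_limit_iff_hlim: "sot_net_limit f L \<longleftrightarrow> (\<forall>v. hlim monoid_at_top (\<lambda>s. f s v) (L v))"
proof -
  have "(\<forall>s. (\<exists>r. s0 + r = s) \<longrightarrow> P s) \<longleftrightarrow> (\<forall>r. P (s0 + r))" for s0 :: 'a and P
    by auto
  then show ?thesis
    by (simp add: sot_net_limit_def hlim_def tendsto_iff eventually_monoid_at_top)
qed

text \<open>Completeness is available for sequences only. Indices \<open>s n\<close> whose tails
  oscillate by less than \<open>1 / (n + 1)\<close> give a Cauchy sequence, and the small tails
  carry its limit over to the net.\<close>

lemma hlim_net_if_Cauchy:
  fixes v :: "'s::comm_monoid_add \<Rightarrow> 'h::chilbert"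
  assumes "\<And>e. e > 0 \<Longrightarrow> \<exists>s. \<forall>r. hnorm (v (s + r) - v s) < e"
  shows "\<exists>l. hlim monoid_at_top v l"
proof -
  define b where "b n = 1 / real (Suc n)" for n
  have b: "b \<longlonglongrightarrow> 0"
    unfolding b_def using LIMSEQ_inverse_real_of_nat by (simp add: divide_inverse)
  have "\<exists>s. \<forall>r. hnorm (v (s + r) - v s) < b n" for n
    by (rule assms) (simp add: b_def)
  then obtain s where s: "\<And>n r. hnorm (v (s n + r) - v (s n)) < b n"
    by metis
  \<comment> \<open>The two indices are compared through their common upper bound
    \<open>s m + s n\<close>.\<close>
  have "hnorm (v (s m) - v (s n)) \<le> b m + b n" for m n
    using hnorm_triangle_diff[of "v (s m)" "v (s n)" "v (s m + s n)"] s[of m "s n"] s[of n "s m"]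
    by (simp add: add.commute[of "s n"] hnorm_minus_commute[of "v (s m)"])
  then obtain l where l: "hlim sequentially (\<lambda>n. v (s n)) l"
    using hlim_sequentially_if_Cauchy[OF _ b, of "\<lambda>n. v (s n)"] by blast
  have "\<forall>\<^sub>F i in monoid_at_top. hnorm (v i - l) < e" if "e > 0" for e
  proof -
    have "(\<lambda>n. b n + hnorm (v (s n) - l)) \<longlonglongrightarrow> 0"
      using tendsto_add[OF b l[unfolded hlim_def]] by simp
    then have "\<forall>\<^sub>F n in sequentially. b n + hnorm (v (s n) - l) < e"
      by (rule order_tendstoD(2)[OF _ that])
    then obtain n where n: "b n + hnorm (v (s n) - l) < e"
      by (auto dest: eventually_happens)
    have "hnorm (v (s n + r) - l) < e" for r
      using hnorm_triangle_diff[of "v (s n + r)" l "v (s n)"] s[of n r] n by linarith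
    then show ?thesis
      by (auto simp: eventually_monoid_at_top)
  qed
  then have "hlim monoid_at_top v l"
    by (simp add: hlim_def tendsto_iff)
  then show ?thesis ..
qed

section \<open>Semigroups of contractive completely positive normal maps\<close>

locale cp_semigroup = vN_algebra N for N :: "('h::chilbert \<Rightarrow> 'h) set" +
  fixes \<phi> :: "'s::comm_monoid_add \<Rightarrow> ('h \<Rightarrow> 'h) \<Rightarrow> ('h \<Rightarrow> 'h)"
  assumes maps_into: "\<And>s x. x \<in> N \<Longrightarrow> \<phi> s x \<in> N"
    and cp: "\<And>s. completely_positive N (\<phi> s)"
    and contr: "\<And>s. contractive N (\<phi> s)"
    and wstar: "\<And>s. weak_star_continuous N (\<phi> s)"
    and sg0: "\<And>x. x \<in> N \<Longrightarrow> \<phi> 0 x = x"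
    and sg_add: "\<And>s t x. x \<in> N \<Longrightarrow> \<phi> (s + t) x = \<phi> s (\<phi> t x)"
begin

sublocale phi: cp_contraction N "\<phi> s" for s
  by unfold_locales (simp_all add: maps_into cp contr)

abbreviation Fix :: "('h \<Rightarrow> 'h) set" where
  "Fix \<equiv> fixed_points N \<phi>"

lemma Fix_N: "x \<in> Fix \<Longrightarrow> x \<in> N"
  by (simp add: fixed_points_def)

lemma Fix_fixed: "x \<in> Fix \<Longrightarrow> \<phi> t x = x"
  by (simp add: fixed_points_def)

lemma Fix_adjoint: "x \<in> Fix \<Longrightarrow> adjoint x \<in> Fix"
  by (auto simp: fixed_points_def N_adjoint simp flip: phi.adjoint_f)

lemma Fix_op_add: "x \<in> Fix \<Longrightarrow> y \<in> Fix \<Longrightarrow> op_add x y \<in> Fix"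
  by (simp add: fixed_points_def N_op_add phi.f_op_add)

lemma Fix_op_scale: "x \<in> Fix \<Longrightarrow> op_scale c x \<in> Fix"
  by (simp add: fixed_points_def N_op_scale phi.f_op_scale)

lemma Fix_zero: "(\<lambda>_. 0) \<in> Fix"
proof -
  have eq: "op_scale 0 x = (\<lambda>_. 0)" for x :: "'h \<Rightarrow> 'h"
    by (simp add: op_scale_def)
  show ?thesis
    using phi.f_op_scale[OF N_zero, of _ 0] by (simp add: fixed_points_def N_zero eq)
qed

section \<open>The null ideal\<close>

definition null_ideal :: "('h \<Rightarrow> 'h) set" where
  "null_ideal = {d \<in> N. \<forall>v. ((\<lambda>s. Re (cinner (\<phi> s (abs_sq d) v) v)) \<longlongrightarrow> 0) monoid_at_top}"

lemma null_idealI: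
  assumes "d \<in> N"
    and "\<And>v. \<exists>g. (g \<longlongrightarrow> 0) monoid_at_top \<and> (\<forall>s. Re (cinner (\<phi> s (abs_sq d) v) v) \<le> g s)"
  shows "d \<in> null_ideal"
  unfolding null_ideal_def
proof (intro CollectI conjI allI assms(1))
  fix v
  obtain g where g: "(g \<longlongrightarrow> 0) monoid_at_top" "\<And>s. Re (cinner (\<phi> s (abs_sq d) v) v) \<le> g s"
    using assms(2) by blast
  show "((\<lambda>s. Re (cinner (\<phi> s (abs_sq d) v) v)) \<longlongrightarrow> 0) monoid_at_top"
    by (rule tendsto_sandwich[OF _ _ tendsto_const g(1)])
      (use g(2) phi.f_abs_sq_nonneg[OF assms(1)] in simp_all)
qed

lemma null_ideal_N: "d \<in> null_ideal \<Longrightarrow> d \<in> N"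
  by (simp add: null_ideal_def)

lemma null_ideal_tendsto:
  "d \<in> null_ideal \<Longrightarrow> ((\<lambda>s. Re (cinner (\<phi> s (abs_sq d) v) v)) \<longlongrightarrow> 0) monoid_at_top"
  by (simp add: null_ideal_def)

lemma null_ideal_op_add:
  assumes "d \<in> null_ideal" "e \<in> null_ideal"
  shows "op_add d e \<in> null_ideal"
proof (rule null_idealI, intro N_op_add null_ideal_N assms, intro exI conjI allI)
  fix v s
  show "((\<lambda>s. 2 * Re (cinner (\<phi> s (abs_sq d) v) v) + 2 * Re (cinner (\<phi> s (abs_sq e) v) v)) \<longlongrightarrow> 0) monoid_at_top"
    using tendsto_add[OF tendsto_mult_left[OF null_ideal_tendsto[OF assms(1)], of 2]
        tendsto_mult_left[OF null_ideal_tendsto[OF assms(2)], of 2]] by simp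
  show "Re (cinner (\<phi> s (abs_sq (op_add d e)) v) v)
      \<le> 2 * Re (cinner (\<phi> s (abs_sq d) v) v) + 2 * Re (cinner (\<phi> s (abs_sq e) v) v)"
    by (intro phi.f_abs_sq_add_le null_ideal_N assms)
qed

lemma null_ideal_comp:
  assumes "z \<in> N" "d \<in> null_ideal"
  shows "z \<circ> d \<in> null_ideal"
proof (rule null_idealI, intro N_comp null_ideal_N assms, intro exI conjI allI)
  fix v s
  show "((\<lambda>s. (opnorm z)\<^sup>2 * Re (cinner (\<phi> s (abs_sq d) v) v)) \<longlongrightarrow> 0) monoid_at_top"
    using tendsto_mult_left[OF null_ideal_tendsto[OF assms(2)], of "(opnorm z)\<^sup>2"] by simp
  show "Re (cinner (\<phi> s (abs_sq (z \<circ> d)) v) v) \<le> (opnorm z)\<^sup>2 * Re (cinner (\<phi> s (abs_sq d) v) v)"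
    by (intro phi.f_abs_sq_comp_le null_ideal_N assms)
qed

lemma null_ideal_op_scale:
  assumes "d \<in> null_ideal"
  shows "op_scale c d \<in> null_ideal"
proof -
  have "op_scale c d = op_scale c (\<lambda>x. x) \<circ> d"
    by (simp add: op_scale_def comp_def)
  then show ?thesis
    using null_ideal_comp[OF N_op_scale[OF N_id] assms] by simp
qed

lemma null_ideal_norm_closed:
  assumes x: "x \<in> N" and approx: "\<And>e. e > 0 \<Longrightarrow> \<exists>d\<in>null_ideal. opnorm (op_diff x d) < e"
  shows "x \<in> null_ideal"
  unfolding null_ideal_def
proof (intro CollectI conjI allI x tendstoI)
  fix v :: 'h and e :: real assume e: "e > 0"
  \<comment> \<open>With \<open>x = (x - d) + d\<close>, the bound for sums doubles each
    contribution, so each may be at most \<open>e / 4\<close>. The first is bounded uniformly in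
    \<open>s\<close> through the norm of \<open>x - d\<close>; the \<open>+ 1\<close> covers
    \<open>v = 0\<close>.\<close>
  define \<delta> where "\<delta> = sqrt (e / (4 * ((hnorm v)\<^sup>2 + 1)))"
  have h: "(hnorm v)\<^sup>2 + 1 > 0"
    by (simp add: add_nonneg_pos)
  then have \<delta>: "\<delta> > 0" "\<delta>\<^sup>2 = e / (4 * ((hnorm v)\<^sup>2 + 1))"
    using e by (simp_all add: \<delta>_def)
  obtain d where d: "d \<in> null_ideal" "opnorm (op_diff x d) < \<delta>"
    using approx[OF \<delta>(1)] by blast
  have dN: "d \<in> N"
    by (rule null_ideal_N[OF d(1)])
  have "(opnorm (op_diff x d))\<^sup>2 \<le> \<delta>\<^sup>2"
    using d(2) by (intro power_mono opnorm_nonneg N_bounded N_op_diff x dN) simp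
  then have "(opnorm (op_diff x d))\<^sup>2 * (hnorm v)\<^sup>2 \<le> \<delta>\<^sup>2 * (hnorm v)\<^sup>2"
    by (rule mult_right_mono) simp
  also have "\<dots> \<le> \<delta>\<^sup>2 * ((hnorm v)\<^sup>2 + 1)"
    by (rule mult_left_mono) simp_all
  also have "\<dots> = e / 4"
    using h unfolding \<delta>(2) by (simp add: field_simps)
  finally have small: "Re (cinner (\<phi> s (abs_sq (op_diff x d)) v) v) \<le> e / 4" for s
    using phi.f_abs_sq_le_opnorm[OF N_op_diff[OF x dN], of s v] by linarith
  have sum: "op_add (op_diff x d) d = x"
    by (simp add: op_add_def op_diff_def)
  have "\<forall>\<^sub>F s in monoid_at_top. Re (cinner (\<phi> s (abs_sq d) v) v) < e / 4"
    by (rule order_tendstoD(2)[OF null_ideal_tendsto[OF d(1)]]) (use e in simp)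
  then show "\<forall>\<^sub>F s in monoid_at_top. dist (Re (cinner (\<phi> s (abs_sq x) v) v)) 0 < e"
  proof eventually_elim
    case (elim s)
    have "Re (cinner (\<phi> s (abs_sq x) v) v) < e"
      using phi.f_abs_sq_add_le[OF N_op_diff[OF x dN] dN, of s v] small[of s] elim
      unfolding sum by linarith
    then show ?case
      using phi.f_abs_sq_nonneg[OF x, of s v] by simp
  qed
qed

lemma null_ideal_hlim:
  assumes "d \<in> null_ideal"
  shows "hlim monoid_at_top (\<lambda>s. \<phi> s d v) 0"
proof (rule hlim_dominated)
  have "hnorm (\<phi> s d v) \<le> sqrt (Re (cinner (\<phi> s (abs_sq d) v) v))" for s
    by (rule real_le_rsqrt) (rule phi.kadison_schwarz[OF null_ideal_N[OF assms]])
  then show "\<forall>\<^sub>F s in monoid_at_top. hnorm (\<phi> s d v - 0) \<le> sqrt (Re (cinner (\<phi> s (abs_sq d) v) v))"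
    by simp
  show "((\<lambda>s. sqrt (Re (cinner (\<phi> s (abs_sq d) v) v))) \<longlongrightarrow> 0) monoid_at_top"
    using tendsto_real_sqrt[OF null_ideal_tendsto[OF assms, of v]] by simp
qed

section \<open>Fixed points modulo the null ideal\<close>

definition fixed_mod_null :: "('h \<Rightarrow> 'h) set" where
  "fixed_mod_null = {y \<in> N. \<exists>c\<in>Fix. op_diff y c \<in> null_ideal}"

lemma fixed_mod_null_N: "y \<in> fixed_mod_null \<Longrightarrow> y \<in> N"
  by (simp add: fixed_mod_null_def)

lemma fixed_mod_null_bounded: "y \<in> fixed_mod_null \<Longrightarrow> bounded_op y"
  by (simp add: fixed_mod_null_N N_bounded)

text \<open>Splitting \<open>y = (y - c) + c\<close> shows that any fixed representative of
  \<open>y\<close> is the strong limit of its orbit. Representatives are therefore unique, although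
  \<open>fixed_mod_null\<close> asks only for existence.\<close>

lemma hlim_if_diff_null:
  assumes "y \<in> N" "c \<in> Fix" "op_diff y c \<in> null_ideal"
  shows "hlim monoid_at_top (\<lambda>s. \<phi> s y v) (c v)"
proof -
  have "\<phi> s y v = \<phi> s (op_diff y c) v + c v" for s
    using assms by (simp add: phi.f_op_diff Fix_N Fix_fixed) (simp add: op_diff_def)
  then show ?thesis
    using hlim_add[OF null_ideal_hlim[OF assms(3), of v] hlim_const[of _ "c v"]] by simp
qed

lemma zero_in_null_ideal: "(\<lambda>_. 0) \<in> null_ideal"
proof -
  have "abs_sq (\<lambda>_. 0) = (\<lambda>_. 0 :: 'h)"
    by (simp add: comp_def bounded_op_zero bounded_op_adjoint bounded_op_const_zero)
  then show ?thesis
    by (simp add: null_ideal_def N_zero Fix_fixed[OF Fix_zero])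
qed

lemma Fix_subset_fixed_mod_null: "Fix \<subseteq> fixed_mod_null"
proof
  fix c assume "c \<in> Fix"
  moreover have "op_diff c c = (\<lambda>_. 0)"
    by (simp add: op_diff_def)
  ultimately show "c \<in> fixed_mod_null"
    by (auto simp: fixed_mod_null_def Fix_N zero_in_null_ideal intro!: bexI[of _ c])
qed

lemma fixed_mod_null_op_add:
  assumes "x \<in> fixed_mod_null" "y \<in> fixed_mod_null"
  shows "op_add x y \<in> fixed_mod_null"
proof -
  obtain c d where c: "c \<in> Fix" "op_diff x c \<in> null_ideal" and d: "d \<in> Fix" "op_diff y d \<in> null_ideal"
    using assms by (auto simp: fixed_mod_null_def)
  have "op_diff (op_add x y) (op_add c d) = op_add (op_diff x c) (op_diff y d)"
    by (simp add: op_diff_def op_add_def algebra_simps)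
  then have "op_diff (op_add x y) (op_add c d) \<in> null_ideal"
    using null_ideal_op_add[OF c(2) d(2)] by simp
  then show ?thesis
    using assms Fix_op_add[OF c(1) d(1)] by (auto simp: fixed_mod_null_def N_op_add)
qed

lemma fixed_mod_null_op_scale:
  assumes "x \<in> fixed_mod_null"
  shows "op_scale k x \<in> fixed_mod_null"
proof -
  obtain c where c: "c \<in> Fix" "op_diff x c \<in> null_ideal"
    using assms by (auto simp: fixed_mod_null_def)
  have "op_diff (op_scale k x) (op_scale k c) = op_scale k (op_diff x c)"
    by (simp add: op_diff_def op_scale_def scaleC_diff_right)
  then have "op_diff (op_scale k x) (op_scale k c) \<in> null_ideal"
    using null_ideal_op_scale[OF c(2)] by simp
  then show ?thesis
    using assms Fix_op_scale[OF c(1)] by (auto simp: fixed_mod_null_def N_op_scale)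
qed

lemma fixed_mod_null_op_diff:
  "x \<in> fixed_mod_null \<Longrightarrow> y \<in> fixed_mod_null \<Longrightarrow> op_diff x y \<in> fixed_mod_null"
  by (simp add: op_diff_eq fixed_mod_null_op_add fixed_mod_null_op_scale)

text \<open>The representatives converge along with the approximants: \<open>c m - c n\<close> is
  the strong limit of \<open>\<phi> s (y m - y n)\<close>, hence no larger in norm than
  \<open>y m - y n\<close>. Their limit \<open>C\<close> is the representative of
  \<open>T\<close>.\<close>

lemma fixed_mod_null_norm_closed:
  assumes T: "bounded_op T" and approx: "\<And>e. e > 0 \<Longrightarrow> \<exists>y\<in>fixed_mod_null. opnorm (op_diff T y) < e"
  shows "T \<in> fixed_mod_null"
proof -
  define b where "b n = 1 / real (Suc n)" for n
  have b: "b \<longlonglongrightarrow> 0"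
    unfolding b_def using LIMSEQ_inverse_real_of_nat by (simp add: divide_inverse)
  have b_bounds: "0 < b n" "b n \<le> 1" for n
    by (simp_all add: b_def)
  have bv: "(\<lambda>n. b n * a) \<longlonglongrightarrow> 0" for a
    using tendsto_mult_right[OF b, of a] by simp
  obtain y where y: "\<And>n. y n \<in> fixed_mod_null" "\<And>n. opnorm (op_diff T (y n)) < b n"
    using approx[OF b_bounds(1)] by metis
  then obtain c where c: "\<And>n. c n \<in> Fix" "\<And>n. op_diff (y n) (c n) \<in> null_ideal"
    unfolding fixed_mod_null_def by simp metis
  have yN: "y n \<in> N" and cN: "c n \<in> N" for n
    using y(1) c(1) by (simp_all add: fixed_mod_null_N Fix_N)
  have T_y: "hnorm (T v - y n v) \<le> b n * hnorm v" for n v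
    using hnorm_le_opnorm[OF bounded_op_op_diff[OF T N_bounded[OF yN]], of n v]
      mult_right_mono[OF less_imp_le[OF y(2)], of "hnorm v" n]
    by (simp add: op_diff_def)
  have TN: "T \<in> N"
  proof (rule N_hlim[OF sequentially_bot yN])
    show "hnorm (y n v) \<le> (opnorm T + 1) * hnorm v" for n v
      using hnorm_triangle[of "T v" "y n v - T v"] T_y[of v n] hnorm_le_opnorm[OF T, of v]
        mult_right_mono[OF b_bounds(2), of "hnorm v" n]
      by (simp add: hnorm_minus_commute[of "y n v"] distrib_right)
    show "hlim sequentially (\<lambda>n. y n v) (T v)" for v
      by (rule hlim_dominated[OF _ bv[of "hnorm v"]]) (use T_y in \<open>simp add: hnorm_minus_commute\<close>)
  qed
  have "opnorm (op_diff (y m) (y n)) \<le> b m + b n" for m n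
    using opnorm_diff_triangle[OF N_bounded[OF yN] T N_bounded[OF yN], of m n] y(2)[of m] y(2)[of n]
    by (simp add: opnorm_op_diff_commute[of "y m"])
  then have c_dist: "hnorm (c m v - c n v) \<le> (b m + b n) * hnorm v" for m n v
  proof -
    have "hlim monoid_at_top (\<lambda>s. \<phi> s (op_diff (y m) (y n)) v) (c m v - c n v)"
      using hlim_diff[OF hlim_if_diff_null[OF yN c, of m v] hlim_if_diff_null[OF yN c, of n v]]
      by (simp add: phi.f_op_diff yN) (simp add: op_diff_def)
    moreover have "hnorm (\<phi> s (op_diff (y m) (y n)) v) \<le> (b m + b n) * hnorm v" for s
      using phi.f_hnorm_le[OF N_op_diff[OF yN yN], of s m n v]
        mult_right_mono[OF \<open>opnorm (op_diff (y m) (y n)) \<le> b m + b n\<close>, of "hnorm v"] by simp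
    ultimately show ?thesis
      by (intro tendsto_upperbound[OF hlim_hnorm]) auto
  qed
  have "\<exists>l. hlim sequentially (\<lambda>n. c n v) l" for v
    by (rule hlim_sequentially_if_Cauchy[OF _ bv[of "hnorm v"]])
      (use c_dist in \<open>simp add: distrib_right\<close>)
  then obtain C where C: "\<And>v. hlim sequentially (\<lambda>n. c n v) (C v)"
    by metis
  have c_C: "hnorm (c n v - C v) \<le> b n * hnorm v" for n v
  proof (rule tendsto_le[OF sequentially_bot])
    show "(\<lambda>m. (b n + b m) * hnorm v) \<longlonglongrightarrow> b n * hnorm v"
      using tendsto_mult_right[OF tendsto_add[OF tendsto_const b], of "b n" "hnorm v"] by simp
    show "(\<lambda>m. hnorm (c n v - c m v)) \<longlonglongrightarrow> hnorm (c n v - C v)"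
      by (intro hlim_hnorm hlim_diff hlim_const C)
  qed (use c_dist in simp)
  have CN: "C \<in> N"
  proof (rule N_hlim[OF sequentially_bot cN _ C])
    show "hnorm (c n v) \<le> (opnorm (c 0) + 2) * hnorm v" for n v
      using hnorm_triangle[of "c 0 v" "c n v - c 0 v"] c_dist[of n v 0]
        hnorm_le_opnorm[OF N_bounded[OF cN], of 0 v]
        mult_right_mono[OF add_mono[OF b_bounds(2) b_bounds(2)], of "hnorm v" n 0]
      by (simp add: distrib_right)
  qed
  have op_c_C: "opnorm (op_diff (c n) C) \<le> b n" for n
    by (rule opnorm_le) (use c_C b_bounds(1)[of n] in \<open>auto simp: op_diff_def\<close>)
  \<comment> \<open>Since \<open>c n\<close> is fixed, \<open>c n - \<phi> t C\<close> equals
    \<open>\<phi> t (c n - C)\<close>, and contractivity makes it vanish.\<close>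
  have "\<phi> t C v = C v" for t v
  proof (rule hlim_unique[OF sequentially_bot _ C])
    show "hlim sequentially (\<lambda>n. c n v) (\<phi> t C v)"
    proof (rule hlim_dominated[OF _ bv[of "hnorm v"]])
      have "hnorm (\<phi> t (op_diff (c n) C) v) \<le> b n * hnorm v" for n
        using phi.f_hnorm_le[OF N_op_diff[OF cN CN], of t n v] mult_right_mono[OF op_c_C, of "hnorm v" n]
        by simp
      then show "\<forall>\<^sub>F n in sequentially. hnorm (c n v - \<phi> t C v) \<le> b n * hnorm v"
        using c(1) by (simp add: phi.f_op_diff cN CN Fix_fixed) (simp add: op_diff_def)
    qed
  qed
  then have C_Fix: "C \<in> Fix"
    by (auto simp: fixed_points_def CN fun_eq_iff)
  have "op_diff T C \<in> null_ideal"
  proof (rule null_ideal_norm_closed[OF N_op_diff[OF TN CN]])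
    fix e :: real assume "e > 0"
    then have "\<forall>\<^sub>F n in sequentially. b n * 2 < e"
      by (rule order_tendstoD(2)[OF bv])
    then obtain n where n: "b n * 2 < e"
      by (auto dest: eventually_happens)
    \<comment> \<open>After regrouping, both summands have norm at most \<open>b n\<close>, whence
      the threshold \<open>b n * 2 < e\<close>.\<close>
    have "op_diff (op_diff T C) (op_diff (y n) (c n)) = op_add (op_diff T (y n)) (op_diff (c n) C)"
      by (simp add: op_diff_def op_add_def algebra_simps)
    then have "opnorm (op_diff (op_diff T C) (op_diff (y n) (c n))) < e"
      using opnorm_triangle[OF N_bounded[OF N_op_diff[OF TN yN]] N_bounded[OF N_op_diff[OF cN CN]], of n n]
        y(2)[of n] op_c_C[of n] n by simp
    then show "\<exists>d\<in>null_ideal. opnorm (op_diff (op_diff T C) d) < e"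
      using c(2) by blast
  qed
  then show ?thesis
    using TN C_Fix by (auto simp: fixed_mod_null_def)
qed

section \<open>Normality and the increasing net of a fixed point\<close>

lemma normal_functional_cinner: "normal_functional N (\<lambda>x. cinner (x u) w)"
  unfolding normal_functional_def
proof (intro exI conjI ballI)
  let ?\<xi> = "\<lambda>n::nat. if n = 0 then u else 0" and ?\<eta> = "\<lambda>n::nat. if n = 0 then w else 0"
  show "summable (\<lambda>n. (hnorm (?\<xi> n))\<^sup>2)" "summable (\<lambda>n. (hnorm (?\<eta> n))\<^sup>2)"
    by (rule summable_finite[of "{0}"]; simp)+
  show "cinner (x u) w = (\<Sum>n. cinner (x (?\<xi> n)) (?\<eta> n))" for x
    by (subst suminf_finite[of "{0}"]) auto
qed

text \<open>Dominated convergence in the series that represents the pulled-back vector functional; the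
  only use of weak* continuity.\<close>

lemma phi_bounded_sot_limit:
  assumes F: "F \<noteq> bot" and T: "\<And>i. T i \<in> N" and L: "L \<in> N"
    and bound: "\<And>i v. hnorm (T i v) \<le> K * hnorm v" and lim: "\<And>v. hlim F (\<lambda>i. T i v) (L v)"
  shows "((\<lambda>i. cinner (\<phi> t (T i) u) w) \<longlongrightarrow> cinner (\<phi> t L u) w) F"
proof -
  have "normal_functional N ((\<lambda>x. cinner (x u) w) \<circ> \<phi> t)"
    using wstar[of t] normal_functional_cinner by (auto simp: weak_star_continuous_def)
  then obtain \<xi> \<eta> where sum: "summable (\<lambda>n. (hnorm (\<xi> n))\<^sup>2)" "summable (\<lambda>n. (hnorm (\<eta> n))\<^sup>2)"
    and eq: "\<And>x. x \<in> N \<Longrightarrow> cinner (\<phi> t x u) w = (\<Sum>n. cinner (x (\<xi> n)) (\<eta> n))"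
    by (auto simp: normal_functional_def)
  \<comment> \<open>A summable majorant independent of \<open>i\<close>: Cauchy-Schwarz, then a
    product is at most the sum of the squares. The absolute value is taken because no sign of
    \<open>K\<close> is assumed.\<close>
  define B where "B k = \<bar>K\<bar> * ((hnorm (\<xi> k))\<^sup>2 + (hnorm (\<eta> k))\<^sup>2)" for k
  have "summable B"
    unfolding B_def by (intro summable_mult summable_add sum)
  moreover have "cmod (cinner (T i (\<xi> k)) (\<eta> k)) \<le> B k" for i k
  proof -
    have "cmod (cinner (T i (\<xi> k)) (\<eta> k)) \<le> hnorm (T i (\<xi> k)) * hnorm (\<eta> k)"
      by (rule cinner_bound)
    also have "\<dots> \<le> (K * hnorm (\<xi> k)) * hnorm (\<eta> k)"
      by (intro mult_right_mono bound) simp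
    also have "\<dots> \<le> \<bar>K\<bar> * (hnorm (\<xi> k) * hnorm (\<eta> k))"
      unfolding mult.assoc by (intro mult_right_mono) simp_all
    also have "\<dots> \<le> B k"
      unfolding B_def
    proof (rule mult_left_mono)
      show "hnorm (\<xi> k) * hnorm (\<eta> k) \<le> (hnorm (\<xi> k))\<^sup>2 + (hnorm (\<eta> k))\<^sup>2"
        using sum_squares_bound[of "hnorm (\<xi> k)" "hnorm (\<eta> k)"]
          mult_nonneg_nonneg[OF hnorm_ge_zero hnorm_ge_zero, of "\<xi> k" "\<eta> k"] by linarith
    qed simp
    finally show ?thesis .
  qed
  ultimately have "((\<lambda>i. \<Sum>k. cinner (T i (\<xi> k)) (\<eta> k)) \<longlongrightarrow> (\<Sum>k. cinner (L (\<xi> k)) (\<eta> k))) F"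
    by (intro tannerys_theorem[where M = B, THEN conjunct2, THEN conjunct2] hlim_cinner lim F
        always_eventually) auto
  then show ?thesis
    by (simp add: eq T L)
qed

text \<open>By Schwarz the net \<open>\<phi> s (a\<^sup>* a)\<close> increases; its limit \<open>c\<close> is a fixed point, and
  \<open>(c - a\<^sup>* a)\<^sup>2 \<le> k (c - a\<^sup>* a)\<close> puts the difference in the null ideal.\<close>

lemma abs_sq_in_fixed_mod_null:
  assumes a: "a \<in> Fix"
  shows "abs_sq a \<in> fixed_mod_null"
proof -
  define T where "T s = \<phi> s (abs_sq a)" for s
  define K where "K = opnorm (abs_sq a) + 1"
  have QN: "abs_sq a \<in> N"
    using a by (simp add: N_comp N_adjoint Fix_N)
  have TN: "T s \<in> N" for s
    by (simp add: T_def maps_into QN)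
  note T_bdd = N_bounded[OF TN]
  have K: "K > 0"
    using opnorm_nonneg[OF N_bounded[OF QN]] by (simp add: K_def)
  have T_K: "hnorm (T s v) \<le> K * hnorm v" for s v
    using phi.f_hnorm_le[OF QN, of s v] hnorm_ge_zero[of v] by (simp add: T_def K_def distrib_right del: hnorm_ge_zero)
  have T_add: "T (s + r) = \<phi> s (T r)" for s r
    by (simp add: T_def sg_add QN)
  \<comment> \<open>Schwarz with \<open>\<phi> r a = a\<close> reads
    \<open>a\<^sup>* a \<le> \<phi> r (a\<^sup>* a)\<close>. Applying \<open>\<phi> s\<close> to
    this inequality then gives monotonicity of the whole net.\<close>
  have pos0: "pos_op (op_diff (T r) (abs_sq a))" for r
    unfolding pos_op_def
  proof (intro allI)
    fix v
    have "pos_op (T r)"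
      unfolding T_def by (rule phi.f_pos[OF QN]) (simp add: pos_op_def cinner_abs_sq[unfolded comp_def] N_bounded Fix_N a)
    moreover have "(hnorm (a v))\<^sup>2 \<le> Re (cinner (T r v) v)"
      using phi.kadison_schwarz[OF Fix_N[OF a], of r v] by (simp add: T_def Fix_fixed[OF a])
    ultimately show "Im (cinner (op_diff (T r) (abs_sq a) v) v) = 0 \<and>
        0 \<le> Re (cinner (op_diff (T r) (abs_sq a) v) v)"
      unfolding op_diff_def cinner_diff_left cinner_abs_sq[OF N_bounded[OF Fix_N[OF a]]]
      by (simp add: pos_op_def)
  qed
  have pos: "pos_op (op_diff (T (s + r)) (T s))" for s r
    using phi.f_pos[OF N_op_diff[OF TN QN] pos0, of s r]
    unfolding phi.f_op_diff[OF TN QN] T_add by (simp add: T_def)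
  have "\<exists>l. hlim monoid_at_top (\<lambda>s. T s v) l" for v
  proof (rule hlim_net_if_Cauchy)
    fix e :: real assume e: "e > 0"
    define g where "g s = Re (cinner (T s v) v)" for s
    have "g s \<le> K * hnorm v * hnorm v" for s
      using Re_cinner_le[of "T s v" v] mult_right_mono[OF T_K[of s v], of "hnorm v"] by (simp add: g_def)
    then have bdd: "bdd_above (range g)"
      by (auto intro!: bdd_aboveI)
    \<comment> \<open>Increments of the net are positive with norm bound \<open>2 * K\<close>, so
      the squared norm of an increment at \<open>v\<close> is at most \<open>2 * K\<close> times the
      increment of \<open>g\<close>. Beyond an index within \<open>e\<^sup>2 / (2 * K)\<close> of
      the supremum this is below \<open>e\<^sup>2\<close>.\<close>
    have pos_e: "e\<^sup>2 / (2 * K) > 0"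
      using e K by simp
    then have "\<exists>x\<in>range g. Sup (range g) - e\<^sup>2 / (2 * K) < x"
      using less_cSup_iff[of "range g" "Sup (range g) - e\<^sup>2 / (2 * K)"] bdd by simp
    then obtain s where s: "Sup (range g) - e\<^sup>2 / (2 * K) < g s"
      by auto
    have "hnorm (T (s + r) v - T s v) < e" for r
    proof -
      let ?D = "op_diff (T (s + r)) (T s)"
      have D_le: "hnorm (?D u) \<le> (2 * K) * hnorm u" for u
        using hnorm_triangle[of "T (s + r) u" "- T s u"] T_K[of "s + r" u] T_K[of s u]
        by (simp add: op_diff_def)
      have "(hnorm (?D v))\<^sup>2 \<le> (2 * K) * Re (cinner (?D v) v)"
        by (rule pos_op_hnorm_sq_le[OF bounded_op_op_diff[OF T_bdd T_bdd] pos _ D_le]) (use K in simp)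
      also have "\<dots> = (2 * K) * (g (s + r) - g s)"
        by (simp add: op_diff_def g_def cinner_diff_left)
      also have "\<dots> < (2 * K) * (e\<^sup>2 / (2 * K))"
      proof (rule mult_strict_left_mono)
        have "g (s + r) \<le> Sup (range g)"
          by (rule cSup_upper[OF _ bdd]) simp
        with s show "g (s + r) - g s < e\<^sup>2 / (2 * K)"
          by linarith
      qed (use K in simp)
      also have "\<dots> = e\<^sup>2"
        using K by simp
      finally show ?thesis
        using e by (simp add: op_diff_def power2_less_imp_less)
    qed
    then show "\<exists>s. \<forall>r. hnorm (T (s + r) v - T s v) < e"
      by blast
  qed
  then obtain c where c: "\<And>v. hlim monoid_at_top (\<lambda>s. T s v) (c v)"
    by metis
  have cN: "c \<in> N"
    by (rule N_hlim[OF monoid_at_top_neq_bot TN T_K c])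
  \<comment> \<open>The net \<open>\<phi> t (T s) = T (t + s)\<close> has two weak limits:
    \<open>\<phi> t c\<close> by normality, and \<open>c\<close> by translation invariance.\<close>
  have "\<phi> t c v = c v" for t v
  proof (rule cinner_eqI)
    fix w
    have "((\<lambda>s. cinner (T (t + s) v) w) \<longlongrightarrow> cinner (\<phi> t c v) w) monoid_at_top"
      using phi_bounded_sot_limit[OF monoid_at_top_neq_bot TN cN T_K c] by (simp add: T_add)
    moreover have "((\<lambda>s. cinner (T (t + s) v) w) \<longlongrightarrow> cinner (c v) w) monoid_at_top"
      using filterlim_compose[OF hlim_cinner[OF c] filterlim_add_monoid_at_top] by simp
    ultimately show "cinner (\<phi> t c v) w = cinner (c v) w"
      by (rule tendsto_unique[OF monoid_at_top_neq_bot])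
  qed
  then have c_Fix: "c \<in> Fix"
    by (auto simp: fixed_points_def cN fun_eq_iff)
  define d where "d = op_diff c (abs_sq a)"
  have dN: "d \<in> N"
    unfolding d_def by (rule N_op_diff[OF cN QN])
  have "pos_op d"
    unfolding pos_op_def
  proof (intro allI)
    fix v
    have lim: "((\<lambda>s. cinner (op_diff (T s) (abs_sq a) v) v) \<longlongrightarrow> cinner (d v) v) monoid_at_top"
      unfolding d_def op_diff_def by (intro hlim_cinner hlim_diff c hlim_const)
    have "((\<lambda>s. Im (cinner (op_diff (T s) (abs_sq a) v) v)) \<longlongrightarrow> Im (cinner (d v) v)) monoid_at_top"
      by (rule tendsto_Im[OF lim])
    then have "((\<lambda>s::'s. 0::real) \<longlongrightarrow> Im (cinner (d v) v)) monoid_at_top"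
      using pos0 by (simp add: pos_op_def)
    then have "Im (cinner (d v) v) = 0"
      by (simp add: tendsto_const_iff)
    moreover have "0 \<le> Re (cinner (d v) v)"
      by (rule tendsto_lowerbound[OF tendsto_Re[OF lim]]) (use pos0 in \<open>auto simp: pos_op_def\<close>)
    ultimately show "Im (cinner (d v) v) = 0 \<and> 0 \<le> Re (cinner (d v) v)" ..
  qed
  define k where "k = opnorm d + 1"
  have k: "k > 0"
    using opnorm_nonneg[OF N_bounded[OF dN]] by (simp add: k_def)
  have d_sq: "(hnorm (d v))\<^sup>2 \<le> k * Re (cinner (d v) v)" for v
  proof (rule pos_op_hnorm_sq_le[OF N_bounded[OF dN] \<open>pos_op d\<close> k])
    show "hnorm (d u) \<le> k * hnorm u" for u
      using hnorm_le_opnorm[OF N_bounded[OF dN], of u] hnorm_ge_zero[of u]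
      by (simp add: k_def distrib_right del: hnorm_ge_zero)
  qed
  have "d \<in> null_ideal"
  proof (rule null_idealI[OF dN], intro exI conjI allI)
    fix v s
    \<comment> \<open>Because \<open>c\<close> is fixed, the orbit of \<open>d\<close> is the error
      \<open>c - T s\<close>, which tends to zero and, up to the factor \<open>k\<close>, dominates
      the orbit of \<open>d\<^sup>* d\<close>.\<close>
    have phi_d: "\<phi> s d = op_diff c (T s)" for s
      unfolding d_def T_def phi.f_op_diff[OF cN QN] Fix_fixed[OF c_Fix] ..
    have "((\<lambda>s. k * Re (cinner (c v - T s v) v)) \<longlongrightarrow> k * Re (cinner (c v - c v) v)) monoid_at_top"
      by (intro tendsto_mult_left tendsto_Re hlim_cinner hlim_diff hlim_const c)
    then show "((\<lambda>s. k * Re (cinner (\<phi> s d v) v)) \<longlongrightarrow> 0) monoid_at_top"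
      by (simp add: phi_d op_diff_def)
    have "Re (cinner (\<phi> s (abs_sq d) v) v) \<le> Re (cinner (\<phi> s (op_scale (of_real k) d) v) v)"
      by (rule phi.f_abs_sq_le[OF dN N_op_scale[OF dN]])
        (use d_sq \<open>pos_op d\<close> in \<open>simp_all add: op_scale_def cinner_scaleC_left pos_op_def\<close>)
    then show "Re (cinner (\<phi> s (abs_sq d) v) v) \<le> k * Re (cinner (\<phi> s d v) v)"
      unfolding phi.f_op_scale[OF dN] by (simp add: op_scale_def cinner_scaleC_left)
  qed
  then have "op_scale (- 1) d \<in> null_ideal"
    by (rule null_ideal_op_scale)
  moreover have "op_scale (- 1) d = op_diff (abs_sq a) c"
    by (simp add: d_def op_scale_def op_diff_def scaleC_minus1)
  ultimately show ?thesis
    using QN c_Fix by (auto simp: fixed_mod_null_def)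
qed

section \<open>Products of fixed points and the C*-algebra of multipliers\<close>

lemma Fix_comp_Fix:
  assumes "a \<in> Fix" "b \<in> Fix"
  shows "a \<circ> b \<in> fixed_mod_null"
proof -
  define a' where "a' = adjoint a"
  have a': "a' \<in> Fix"
    using Fix_adjoint[OF assms(1)] by (simp add: a'_def)
  have a_eq: "a = adjoint a'"
    using assms(1) by (simp add: a'_def adjoint_involution N_bounded Fix_N)
  \<comment> \<open>The mixed terms of the square of \<open>a' + z b\<close>, namely
    \<open>z a'\<^sup>* b + cnj z b\<^sup>* a'\<close>. Combining \<open>z = 1\<close> with
    \<open>- \<i>\<close> times the case \<open>z = \<i>\<close> cancels the second term and leaves
    \<open>2 a'\<^sup>* b = 2 a b\<close>.\<close>
  define X where "X z = op_diff (abs_sq (op_add a' (op_scale z b))) (op_add (abs_sq a') (abs_sq (op_scale z b)))" for z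
  have X: "X z \<in> fixed_mod_null" for z
    unfolding X_def
    by (intro fixed_mod_null_op_diff fixed_mod_null_op_add abs_sq_in_fixed_mod_null
        Fix_op_add Fix_op_scale a' assms(2))
  have cinner_sq: "cinner (abs_sq x v) w = cinner (x v) (x w)" if "x \<in> Fix" for x v w
    using that by (simp add: cinner_adjoint' N_bounded Fix_N)
  have cinner_X: "cinner (X z v) w = z * cinner (b v) (a' w) + cnj z * cinner (a' v) (b w)" for z v w
    unfolding X_def op_diff_apply op_add_apply cinner_diff_left cinner_add_left
      cinner_sq[OF a'] cinner_sq[OF Fix_op_scale[OF assms(2)]]
      cinner_sq[OF Fix_op_add[OF a' Fix_op_scale[OF assms(2)]]]
    by (simp add: op_add_apply op_scale_apply cinner_simps)
  have "a \<circ> b = op_scale (1/2) (op_add (X 1) (op_scale (- \<i>) (X \<i>)))"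
  proof (intro ext cinner_eqI)
    fix v w
    show "cinner ((a \<circ> b) v) w = cinner (op_scale (1/2) (op_add (X 1) (op_scale (- \<i>) (X \<i>))) v) w"
      using assms(1) by (simp add: op_scale_apply op_add_apply cinner_simps cinner_X a'_def cinner_adjoint N_bounded Fix_N algebra_simps)
  qed
  then show ?thesis
    using X by (simp add: fixed_mod_null_op_add fixed_mod_null_op_scale)
qed

lemma Fix_comp_fixed_mod_null:
  assumes a: "a \<in> Fix" and m: "m \<in> fixed_mod_null"
  shows "a \<circ> m \<in> fixed_mod_null"
proof -
  obtain c where c: "c \<in> Fix" "op_diff m c \<in> null_ideal"
    using m by (auto simp: fixed_mod_null_def)
  obtain e where e: "e \<in> Fix" "op_diff (a \<circ> c) e \<in> null_ideal"
    using Fix_comp_Fix[OF a c(1)] by (auto simp: fixed_mod_null_def)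
  have "op_diff (a \<circ> m) e = op_add (op_diff (a \<circ> c) e) (a \<circ> op_diff m c)"
    using a by (simp add: fun_eq_iff op_diff_def op_add_def bounded_op_simps N_bounded Fix_N)
  then have "op_diff (a \<circ> m) e \<in> null_ideal"
    using null_ideal_op_add[OF e(2) null_ideal_comp[OF Fix_N[OF a] c(2)]] by simp
  then show ?thesis
    using e(1) a m by (auto simp: fixed_mod_null_def N_comp Fix_N)
qed

text \<open>If \<open>\<phi>\<close> is not unital, left multipliers of \<open>fixed_mod_null\<close> need not belong to it, so
  membership of \<open>y\<close> and its adjoint is imposed separately.\<close>

definition multipliers :: "('h \<Rightarrow> 'h) set" where
  "multipliers = {y \<in> fixed_mod_null. adjoint y \<in> fixed_mod_null \<and>
     (\<forall>m\<in>fixed_mod_null. y \<circ> m \<in> fixed_mod_null \<and> adjoint y \<circ> m \<in> fixed_mod_null)}"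

lemma multipliersD:
  assumes "y \<in> multipliers"
  shows "y \<in> fixed_mod_null" "adjoint y \<in> fixed_mod_null" "bounded_op y"
    "m \<in> fixed_mod_null \<Longrightarrow> y \<circ> m \<in> fixed_mod_null"
    "m \<in> fixed_mod_null \<Longrightarrow> adjoint y \<circ> m \<in> fixed_mod_null"
  using assms by (auto simp: multipliers_def fixed_mod_null_bounded)

lemma Fix_subset_multipliers: "Fix \<subseteq> multipliers"
  using Fix_subset_fixed_mod_null by (auto simp: multipliers_def Fix_adjoint Fix_comp_fixed_mod_null)

text \<open>Phrased for one \<open>m\<close> and arbitrary bounded approximants so that it serves
  \<open>T\<close> and \<open>adjoint T\<close> alike; right composition with \<open>m\<close> is
  norm continuous.\<close>

lemma comp_fixed_mod_null_norm_closed: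
  assumes T: "bounded_op T" and m: "m \<in> fixed_mod_null"
    and approx: "\<And>e. e > 0 \<Longrightarrow> \<exists>a. bounded_op a \<and> a \<circ> m \<in> fixed_mod_null \<and> opnorm (op_diff T a) < e"
  shows "T \<circ> m \<in> fixed_mod_null"
proof (rule fixed_mod_null_norm_closed)
  have m_bdd: "bounded_op m"
    by (rule fixed_mod_null_bounded[OF m])
  show "bounded_op (T \<circ> m)"
    by (rule bounded_op_comp[OF T m_bdd])
  fix e :: real assume e: "e > 0"
  have pos: "opnorm m + 1 > 0"
    using opnorm_nonneg[OF m_bdd] by simp
  obtain a where a: "bounded_op a" "a \<circ> m \<in> fixed_mod_null" "opnorm (op_diff T a) < e / (opnorm m + 1)"
    using approx[of "e / (opnorm m + 1)"] e pos by auto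
  note D = bounded_op_op_diff[OF T a(1)]
  have "opnorm (op_diff (T \<circ> m) (a \<circ> m)) = opnorm (op_diff T a \<circ> m)"
    by (simp add: op_diff_def comp_def)
  also have "\<dots> \<le> opnorm (op_diff T a) * opnorm m"
    by (rule opnorm_comp_le[OF D m_bdd])
  also have "\<dots> \<le> opnorm (op_diff T a) * (opnorm m + 1)"
    by (intro mult_left_mono opnorm_nonneg D) simp
  also have "\<dots> < e"
    using a(3) pos by (simp add: field_simps)
  finally show "\<exists>y\<in>fixed_mod_null. opnorm (op_diff (T \<circ> m) y) < e"
    using a(2) by blast
qed

text \<open>\<open>cstar_generated\<close> is an intersection, so one C*-subalgebra lying between
  \<open>Fix\<close> and \<open>fixed_mod_null\<close> is enough to bound it.\<close>

lemma cstar_subalgebra_multipliers: "cstar_subalgebra multipliers"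
  unfolding cstar_subalgebra_def
proof (intro conjI ballI allI impI)
  show "multipliers \<subseteq> Collect bounded_op"
    by (auto dest: multipliersD)
  show "(\<lambda>x. 0) \<in> multipliers"
    using Fix_zero Fix_subset_multipliers by blast
  show "op_scale c a \<in> multipliers" if "a \<in> multipliers" for c a
  proof -
    note a = multipliersD[OF that]
    have "op_scale k x \<circ> m = op_scale k (x \<circ> m)" for k and x m :: "'h \<Rightarrow> 'h"
      by (simp add: op_scale_def comp_def)
    then show ?thesis
      using a by (auto simp: multipliers_def adjoint_op_scale fixed_mod_null_op_scale)
  qed
  show "adjoint a \<in> multipliers" if "a \<in> multipliers" for a
    using multipliersD[OF that] by (auto simp: multipliers_def adjoint_involution)
  show "T \<in> multipliers" if T: "bounded_op T" and "\<forall>e>0. \<exists>a\<in>multipliers. opnorm (op_diff T a) < e" for T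
  proof -
    \<comment> \<open>The conditions on \<open>T\<close> and on \<open>adjoint T\<close> are
      approximated by one multiplier and its adjoint, since taking adjoints does not increase the
      norm.\<close>
    have approx: "\<exists>a\<in>multipliers. opnorm (op_diff T a) < e \<and> opnorm (op_diff (adjoint T) (adjoint a)) < e"
      if e: "e > 0" for e
    proof -
      obtain a where a: "a \<in> multipliers" "opnorm (op_diff T a) < e"
        using \<open>\<forall>e>0. _\<close> e by blast
      have "opnorm (op_diff (adjoint T) (adjoint a)) \<le> opnorm (op_diff T a)"
        using opnorm_adjoint_le[OF bounded_op_op_diff[OF T multipliersD(3)[OF a(1)]]]
        by (simp add: adjoint_op_diff T multipliersD(3)[OF a(1)])
      with a show ?thesis
        by (auto intro!: bexI[of _ a])
    qed
    have "T \<in> fixed_mod_null"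
      by (rule fixed_mod_null_norm_closed[OF T]) (use approx multipliersD in blast)
    moreover have "adjoint T \<in> fixed_mod_null"
      by (rule fixed_mod_null_norm_closed[OF bounded_op_adjoint[OF T]]) (use approx multipliersD in blast)
    moreover have "T \<circ> m \<in> fixed_mod_null" if "m \<in> fixed_mod_null" for m
      by (rule comp_fixed_mod_null_norm_closed[OF T that]) (use that approx multipliersD in blast)
    moreover have "adjoint T \<circ> m \<in> fixed_mod_null" if "m \<in> fixed_mod_null" for m
      by (rule comp_fixed_mod_null_norm_closed[OF bounded_op_adjoint[OF T] that])
        (use that approx multipliersD bounded_op_adjoint in blast)
    ultimately show ?thesis
      by (simp add: multipliers_def)
  qed
next
  fix a b assume ab: "a \<in> multipliers" "b \<in> multipliers"
  note a = multipliersD[OF ab(1)] and b = multipliersD[OF ab(2)]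
  have "op_add x y \<circ> m = op_add (x \<circ> m) (y \<circ> m)" for x y m :: "'h \<Rightarrow> 'h"
    by (simp add: op_add_def comp_def)
  then show "op_add a b \<in> multipliers"
    using a b by (auto simp: multipliers_def adjoint_op_add fixed_mod_null_op_add)
  \<comment> \<open>Besides associativity, the multiplier conditions are used at
    \<open>m = b\<close>, and at \<open>m = adjoint a\<close> for the adjoint
    \<open>adjoint b \<circ> adjoint a\<close>, to place the product itself in
    \<open>fixed_mod_null\<close>.\<close>
  show "a \<circ> b \<in> multipliers"
    using a b by (auto simp: multipliers_def adjoint_comp comp_assoc)
qed

lemma cstar_generated_subset: "cstar_generated Fix \<subseteq> fixed_mod_null"
  using cstar_subalgebra_multipliers Fix_subset_multipliers multipliersD(1)
  by (auto simp: cstar_generated_def)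

lemma Fix_subset_cstar_generated: "Fix \<subseteq> cstar_generated Fix"
  by (auto simp: cstar_generated_def)

end

section \<open>The limit map\<close>

lemma cstar_generated_closed:
  assumes "a \<in> cstar_generated X" "b \<in> cstar_generated X"
  shows "op_add a b \<in> cstar_generated X" "op_scale c a \<in> cstar_generated X"
  using assms by (auto simp: cstar_generated_def cstar_subalgebra_def)

theorem theorem2:
  fixes N :: "('h::chilbert \<Rightarrow> 'h) set"
    and \<phi> :: "'s::comm_monoid_add \<Rightarrow> ('h \<Rightarrow> 'h) \<Rightarrow> ('h \<Rightarrow> 'h)"
  assumes vN: "von_neumann_algebra N"
    and maps_into: "\<And>s x. x \<in> N \<Longrightarrow> \<phi> s x \<in> N"
    and cp: "\<And>s. completely_positive N (\<phi> s)"
    and contr: "\<And>s. contractive N (\<phi> s)"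
    and wstar: "\<And>s. weak_star_continuous N (\<phi> s)"
    and sg0: "\<And>x. x \<in> N \<Longrightarrow> \<phi> 0 x = x"
    and sg_add: "\<And>s t x. x \<in> N \<Longrightarrow> \<phi> (s + t) x = \<phi> s (\<phi> t x)"
  shows "\<exists>\<Phi>. (\<forall>y\<in>cstar_generated (fixed_points N \<phi>). sot_net_limit (\<lambda>s. \<phi> s y) (\<Phi> y))
           \<and> completely_positive (cstar_generated (fixed_points N \<phi>)) \<Phi>
           \<and> contractive (cstar_generated (fixed_points N \<phi>)) \<Phi>
           \<and> (\<forall>y\<in>cstar_generated (fixed_points N \<phi>). \<Phi> (\<Phi> y) = \<Phi> y)
           \<and> \<Phi> ` cstar_generated (fixed_points N \<phi>) = fixed_points N \<phi>"
proof -
  interpret cp_semigroup N \<phi>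
    by unfold_locales (fact assms)+
  let ?A = "cstar_generated Fix"
  \<comment> \<open>On \<open>?A\<close> the choice is forced, because every admissible
    \<open>c\<close> is the strong limit of the orbit of \<open>y\<close>. Linearity, complete
    positivity and the norm bound are all derived from that limit.\<close>
  define \<Phi> where "\<Phi> y = (SOME c. c \<in> Fix \<and> op_diff y c \<in> null_ideal)" for y
  have \<Phi>: "\<Phi> y \<in> Fix \<and> op_diff y (\<Phi> y) \<in> null_ideal" if "y \<in> ?A" for y
  proof -
    have "\<exists>c. c \<in> Fix \<and> op_diff y c \<in> null_ideal"
      using that cstar_generated_subset by (auto simp: fixed_mod_null_def)
    then show ?thesis
      unfolding \<Phi>_def by (rule someI_ex)
  qed
  have A_N: "y \<in> N" if "y \<in> ?A" for y
    using that cstar_generated_subset fixed_mod_null_N by blast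
  have lim: "hlim monoid_at_top (\<lambda>s. \<phi> s y v) (\<Phi> y v)" if "y \<in> ?A" for y v
    using hlim_if_diff_null[OF A_N[OF that]] \<Phi>[OF that] by blast
  note unique = hlim_unique[OF monoid_at_top_neq_bot]
  have \<Phi>_Fix: "\<Phi> c = c" if "c \<in> Fix" for c
  proof
    fix v
    have "hlim monoid_at_top (\<lambda>s. \<phi> s c v) (\<Phi> c v)"
      by (rule lim) (use that Fix_subset_cstar_generated in blast)
    then show "\<Phi> c v = c v"
      using unique[OF _ hlim_const] that by (simp add: Fix_fixed)
  qed
  have "linear_on ?A \<Phi>"
    unfolding linear_on_def
  proof (intro conjI ballI allI ext)
    fix a b v assume ab: "a \<in> ?A" "b \<in> ?A"
    have "hlim monoid_at_top (\<lambda>s. \<phi> s (op_add a b) v) (\<Phi> a v + \<Phi> b v)"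
      using hlim_add[OF lim[OF ab(1), of v] lim[OF ab(2), of v]]
      unfolding phi.f_op_add[OF A_N[OF ab(1)] A_N[OF ab(2)]] by (simp add: op_add_def)
    then show "\<Phi> (op_add a b) v = op_add (\<Phi> a) (\<Phi> b) v"
      using unique[OF lim[OF cstar_generated_closed(1)[OF ab], of v]] by (simp add: op_add_def[of "\<Phi> a"])
  next
    fix c a v assume a: "a \<in> ?A"
    have "hlim monoid_at_top (\<lambda>s. \<phi> s (op_scale c a) v) (scaleC c (\<Phi> a v))"
      using hlim_scaleC[OF lim[OF a, of v], of c]
      unfolding phi.f_op_scale[OF A_N[OF a]] by (simp add: op_scale_def)
    then show "\<Phi> (op_scale c a) v = op_scale c (\<Phi> a) v"
      using unique[OF lim[OF cstar_generated_closed(2)[OF a a], of c v]] by (simp add: op_scale_def[of c "\<Phi> a"])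
  qed
  moreover have "pos_matrix n (\<lambda>i j. \<Phi> (X i j))"
    if X: "\<forall>i<n. \<forall>j<n. X i j \<in> ?A" and pos: "pos_matrix n X" for n X
    unfolding pos_matrix_def Let_def
  proof
    fix \<xi> :: "nat \<Rightarrow> 'h"
    define q where "q s = (\<Sum>i<n. \<Sum>j<n. cinner (\<phi> s (X i j) (\<xi> j)) (\<xi> i))" for s
    let ?q = "\<Sum>i<n. \<Sum>j<n. cinner (\<Phi> (X i j) (\<xi> j)) (\<xi> i)"
    have "pos_matrix n (\<lambda>i j. \<phi> s (X i j))" for s
      by (rule phi.f_pos_matrix[OF _ pos]) (use X A_N in blast)
    then have q_pos: "Im (q s) = 0" "0 \<le> Re (q s)" for s
      unfolding pos_matrix_def Let_def q_def by blast+
    have q_lim: "(q \<longlongrightarrow> ?q) monoid_at_top"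
      unfolding q_def by (intro tendsto_sum hlim_cinner lim) (use X in auto)
    have "((\<lambda>s::'s. 0::real) \<longlongrightarrow> Im ?q) monoid_at_top"
      using tendsto_Im[OF q_lim] q_pos(1) by simp
    then have "Im ?q = 0"
      by (simp add: tendsto_const_iff)
    moreover have "0 \<le> Re ?q"
      by (rule tendsto_lowerbound[OF tendsto_Re[OF q_lim]]) (use q_pos in auto)
    ultimately show "Im ?q = 0 \<and> 0 \<le> Re ?q" ..
  qed
  ultimately have "completely_positive ?A \<Phi>"
    by (simp add: completely_positive_def)
  moreover have "contractive ?A \<Phi>"
    unfolding contractive_def
  proof
    fix a assume a: "a \<in> ?A"
    show "opnorm (\<Phi> a) \<le> opnorm a"
    proof (rule opnorm_le)
      show "hnorm (\<Phi> a v) \<le> opnorm a * hnorm v" for v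
        by (rule tendsto_upperbound[OF hlim_hnorm[OF lim[OF a]]])
          (use phi.f_hnorm_le[OF A_N[OF a]] in auto)
    qed (rule opnorm_nonneg[OF N_bounded[OF A_N[OF a]]])
  qed
  \<comment> \<open>Values lie in \<open>Fix\<close>, and \<open>\<Phi>\<close> is the identity
    there; the same two facts give idempotence.\<close>
  moreover have "\<Phi> ` ?A = Fix"
    using \<Phi> \<Phi>_Fix Fix_subset_cstar_generated by (auto intro!: image_eqI[OF \<Phi>_Fix[symmetric]])
  ultimately show ?thesis
    using lim \<Phi> \<Phi>_Fix by (intro exI[of _ \<Phi>]) (simp add: sot_net_limit_iff_hlim)
qed

end
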